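(* Consider the planar ($d=2$) Boolean model whose grains are discs centred at the germs with i.i.d. random radii distributed as an almost surely bounded random variable $R$. Let $m_r$ be the mean of the law $\nu_r$ of the normalised length of the arc shadowed by an obstacle intersecting the disc $B_2(0,r)$. Then for $r$ large enough $$\mathbb P\left(\mathfrak V\ge r\right)\le 2\left(\pi(2r\mathbb E[R]+r^2)+2\right)\exp\left(-\pi(2r\mathbb E[R]+r^2)\,m_r\right)$$ and $$\mathbb P\left(\mathfrak V\ge r\right)\ge 2\pi m_r(2r\mathbb E[R]+r^2)\exp\left(-\pi m_r(2r\mathbb E[R]+r^2)\right)+\exp\left(-2\pi m_r(2r\mathbb E[R]+r^2)\right),$$ where $m_r$ satisfies $$m_r\sim\frac{2\,\mathbb E[R]}{\pi r}\qquad (r\to+\infty).$$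
   Context: Let $\mathbf X$ be a homogeneous Poisson point process in $\mathbb R^2$ with intensity measure the Lebesgue measure, and let $(R_x)_{x\in\mathbf X}$ be i.i.d. copies of a positive, almost surely bounded random variable $R$, independent of $\mathbf X$. The occupied phase is $\mathfrak O=\bigcup_{x\in\mathbf X}B_2(x,R_x)$, where $B_2(x,\rho)$ is the disc of centre $x$ and radius $\rho$. The model is conditioned on the event $\{O\notin\mathfrak O\}$ (of positive probability), where $O$ is the origin; $\mathbb P$ denotes the probability under this conditioning. For a unit vector $\mathbf u$, $V(\mathbf u)=\inf\{s>0: s\mathbf u\in\mathfrak O\}$ (with $\inf\emptyset=+\infty$), and the total visibility is $\mathfrak V=\sup_{\|\mathbf u\|=1}V(\mathbf u)$. Law $\nu_r$: under the conditioning, the number of discs $B_2(x,R_x)$ meeting $B_2(0,r)$ is Poisson with mean $\pi(2r\mathbb E[R]+r^2)$, and these discs are i.i.d., with (centre, radius) having law proportional to $\mathbf 1_{\{\rho<\|x\|\le \rho+r\}}\,\mathrm dx\,\mathbb P_R(\mathrm d\rho)$, where $\mathbb P_R$ is the law of $R$. Such a disc $B_2(x,\rho)$ shadows the arc $\{\mathbf u\in\mathbb S^1:\exists s\le r,\ s\mathbf u\in B_2(x,\rho)\}$ of the unit circle; its normalised length is its angular length divided by $2\pi$. $\nu_r$ is the law of this normalised length for one such random disc. *)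

theory Defs
  imports "HOL-Probability.Probability" "HOL-Library.Landau_Symbols"
begin

type_synonym plane = "real ^ 2"

section \<open>The Boolean model\<close>

text \<open>
  A random point configuration is given by a measurable enumeration \<open>X 0, X 1, \<dots>\<close> of its points;
  a Poisson process with intensity Lebesgue measure on the plane is almost surely infinite, so
  enumeration by the natural numbers loses nothing.  Points are counted with multiplicity; that
  they are almost surely distinct follows from the law of the counts.
\<close>

definition point_count :: "(nat \<Rightarrow> 'w \<Rightarrow> plane) \<Rightarrow> plane set \<Rightarrow> 'w \<Rightarrow> nat" where
  "point_count X A \<omega> = card {n. X n \<omega> \<in> A}"

text \<open>
  The Poisson law is written out because \<open>poisson_pmf\<close> is specified only for positive
  rates, whereas null sets (rate 0) are included here.  Local finiteness is required separately
  because \<open>card\<close> maps infinite sets to 0.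
\<close>

definition (in prob_space) lebesgue_poisson_process :: "(nat \<Rightarrow> 'a \<Rightarrow> plane) \<Rightarrow> bool" where
  "lebesgue_poisson_process X \<longleftrightarrow>
     (\<forall>n. random_variable borel (X n)) \<and>
     (\<forall>A. bounded A \<longrightarrow> (AE \<omega> in M. finite {n. X n \<omega> \<in> A})) \<and>
     (\<forall>A\<in>sets borel. bounded A \<longrightarrow>
        (\<forall>k. \<P>(\<omega> in M. point_count X A \<omega> = k) =
               measure lborel A ^ k / fact k * exp (- measure lborel A))) \<and>
     (\<forall>(I :: nat set) A. finite I \<longrightarrow> disjoint_family_on A I \<longrightarrow>
        (\<forall>i\<in>I. A i \<in> sets borel \<and> bounded (A i)) \<longrightarrow>
        indep_vars (\<lambda>_. count_space UNIV) (\<lambda>i. point_count X (A i)) I)"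

text \<open>
  Since the points are enumerated, the radius attached to the germ \<open>X n\<close> is \<open>Rad n\<close>.
  The random variable \<open>R\<close> only serves to carry the common law of the radii; nothing is assumed
  about its dependence on the rest of the model.  Independence of the sequences of germs and radii
  is stated through the sigma-algebras they generate, since \<open>indep_var\<close> requires both random
  variables to have the same type.
\<close>

locale planar_boolean_model = prob_space M
  for M :: "'w measure" +
  fixes X :: "nat \<Rightarrow> 'w \<Rightarrow> plane" and Rad :: "nat \<Rightarrow> 'w \<Rightarrow> real" and R :: "'w \<Rightarrow> real"
  assumes R_measurable: "random_variable borel R"
    and R_positive: "AE \<omega> in M. 0 < R \<omega>"
    and R_bounded: "\<exists>b. AE \<omega> in M. R \<omega> \<le> b"
    and germs_poisson: "lebesgue_poisson_process X"
    and radii_indep: "indep_vars (\<lambda>_. borel) Rad UNIV"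
    and radii_distr: "\<And>n. distr M borel (Rad n) = distr M borel R"
    and germs_radii_indep:
      "indep_set
         {(\<lambda>\<omega> n. X n \<omega>) -` A \<inter> space M | A. A \<in> sets (Pi\<^sub>M UNIV (\<lambda>_::nat. borel))}
         {(\<lambda>\<omega> n. Rad n \<omega>) -` B \<inter> space M | B. B \<in> sets (Pi\<^sub>M UNIV (\<lambda>_::nat. borel))}"

definition occupied_phase ::
    "(nat \<Rightarrow> 'w \<Rightarrow> plane) \<Rightarrow> (nat \<Rightarrow> 'w \<Rightarrow> real) \<Rightarrow> 'w \<Rightarrow> plane set" where
  "occupied_phase X Rad \<omega> = (\<Union>n. cball (X n \<omega>) (Rad n \<omega>))"

section \<open>Visibility\<close>

definition visibility :: "plane set \<Rightarrow> plane \<Rightarrow> ereal" where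
  "visibility Occ u = Inf {ereal s | s. 0 < s \<and> s *\<^sub>R u \<in> Occ}"

definition total_visibility :: "plane set \<Rightarrow> ereal" where
  "total_visibility Occ = (SUP u\<in>sphere 0 1. visibility Occ u)"

text \<open>
  The event \<open>total_visibility \<dots> \<ge> r\<close> is defined by a supremum over uncountably many directions and
  agrees with a measurable event up to a null set (outside of which the discs are locally finite),
  so its probability is taken in the completion of \<open>M\<close>.
\<close>

definition visibility_prob ::
    "'w measure \<Rightarrow> (nat \<Rightarrow> 'w \<Rightarrow> plane) \<Rightarrow> (nat \<Rightarrow> 'w \<Rightarrow> real) \<Rightarrow> real \<Rightarrow> real" where
  "visibility_prob M X Rad r =
     \<P>(\<omega> in completion M. total_visibility (occupied_phase X Rad \<omega>) \<ge> ereal r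
                            \<bar> 0 \<notin> occupied_phase X Rad \<omega>)"

section \<open>Shadowed arcs\<close>

definition shadow :: "real \<Rightarrow> plane \<Rightarrow> real \<Rightarrow> plane set" where
  "shadow r x \<rho> = {u \<in> sphere 0 1. \<exists>s. 0 \<le> s \<and> s \<le> r \<and> s *\<^sub>R u \<in> cball x \<rho>}"

definition normalised_arc_length :: "plane set \<Rightarrow> real" where
  "normalised_arc_length A =
     measure lborel {\<theta> \<in> {0..<2 * pi}. vector [cos \<theta>, sin \<theta>] \<in> A} / (2 * pi)"

text \<open>\<open>PR\<close> is the law of the radius; \<open>uniform_measure\<close> normalises the restriction of
  \<open>lborel \<Otimes>\<^sub>M PR\<close> to a probability measure.\<close>

definition obstacle_law :: "real measure \<Rightarrow> real \<Rightarrow> (plane \<times> real) measure" where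
  "obstacle_law PR r =
     uniform_measure (lborel \<Otimes>\<^sub>M PR) {(x, \<rho>). \<rho> < norm x \<and> norm x \<le> \<rho> + r}"

definition shadow_law :: "real measure \<Rightarrow> real \<Rightarrow> real measure" where
  "shadow_law PR r =
     distr (obstacle_law PR r) borel (\<lambda>(x, \<rho>). normalised_arc_length (shadow r x \<rho>))"

definition mean_shadow :: "real measure \<Rightarrow> real \<Rightarrow> real" where
  "mean_shadow PR r = (\<integral>t. t \<partial>shadow_law PR r)"

end

theory Submission
  imports Defs
begin

text \<open>
  An obstacle shadows a direction up to distance \<open>r\<close> iff its disc meets a segment of length \<open>r\<close>
  issued from the origin. The germs of such discs of radius \<open>\<rho>\<close> fill a stadium minus a disc, of
  area \<open>2 * r * \<rho>\<close>; by Fubini \<open>\<Lambda> * m r = 2 * r * E[R]\<close>, where \<open>\<Lambda>\<close> is the mean number of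
  obstacles within distance \<open>r\<close>. Everything then follows from the void probabilities
  \<open>exp (- \<mu> B)\<close> of the marked process, with intensity \<open>\<mu>\<close> the product of the Lebesgue measure
  and the law of \<open>R\<close>.

  Upper bound: cut the circle into \<open>K\<close> arcs. If some direction is clear, no shadow covers its arc;
  the probability that this happens at the first arc, or at an arc whose predecessor is covered, is
  at most \<open>(1 + \<Lambda>) * exp (- 2 * r * E[R] + \<Lambda> / K)\<close>, because an obstacle covering the
  predecessor only must stop shadowing inside the arc. Let \<open>K\<close> tend to infinity.

  Lower bound: take about \<open>4 * r * E[R] + 2\<close> equispaced directions within one radian. Two of them
  are at angle at least of order \<open>1 / r\<close>, hence the obstacles shadowing one but not the other have
  mean number at least of order \<open>r\<close>, so that the second Bonferroni term is exponentially
  smaller than the first.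
\<close>

section \<open>Poisson processes\<close>

text \<open>With \<open>\<Lambda> * m r = a\<close>, \<open>a = 2 * r * E[R]\<close>, both bounds
  compare with \<open>exp (- a)\<close>, the conditional probability that a fixed direction is clear
  up to distance \<open>r\<close>. Obstacles that cover the origin and obstacles that shadow a
  direction form disjoint classes of marks, so the conditioning only divides by the void probability
  of the former. The obstacle to the upper bound is that the directions are uncountable, and that
  adding the probabilities of the \<open>K\<close> arcs gives about \<open>K * exp (- a)\<close>,
  which explodes as \<open>K\<close> grows. Counting only the changes from a covered to an uncovered
  arc removes the \<open>K\<close>: an obstacle stops shadowing at most once per turn, so all the
  classes that allow such a change have total intensity at most \<Lambda>. A second loss comes from
  the supremum: total visibility at least \<open>r\<close> only yields clear segments of every
  length below \<open>r\<close>. Shortening \<open>r\<close> slightly is what the leading factor 2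
  of the upper bound pays for.\<close>

context prob_space
begin

lemma expectation_power_poisson:
  fixes N :: "'a \<Rightarrow> nat"
  assumes N [measurable]: "random_variable (count_space UNIV) N"
    and law: "\<And>k. \<P>(\<omega> in M. N \<omega> = k) = l ^ k / fact k * exp (- l)"
    and c: "0 \<le> c" "c \<le> 1" and l: "0 \<le> l"
  shows "expectation (\<lambda>\<omega>. c ^ N \<omega>) = exp (- (l * (1 - c)))"
proof -
  have "(\<integral>\<^sup>+\<omega>. ennreal (c ^ N \<omega>) \<partial>M)
      = (\<integral>\<^sup>+\<omega>. (\<Sum>k. ennreal (c ^ k) * indicator {\<omega>\<in>space M. N \<omega> = k} \<omega>) \<partial>M)"
  proof (rule nn_integral_cong)
    fix \<omega> assume "\<omega> \<in> space M"
    then have "(\<Sum>k. ennreal (c ^ k) * indicator {\<omega>\<in>space M. N \<omega> = k} \<omega>)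
        = (\<Sum>k\<in>{N \<omega>}. ennreal (c ^ k) * indicator {\<omega>\<in>space M. N \<omega> = k} \<omega>)"
      by (intro suminf_finite) (auto simp: indicator_def)
    then show "ennreal (c ^ N \<omega>) = (\<Sum>k. ennreal (c ^ k) * indicator {\<omega>\<in>space M. N \<omega> = k} \<omega>)"
      using \<open>\<omega> \<in> space M\<close> by (simp add: indicator_def)
  qed
  also have "\<dots> = (\<Sum>k. \<integral>\<^sup>+\<omega>. ennreal (c ^ k) * indicator {\<omega>\<in>space M. N \<omega> = k} \<omega> \<partial>M)"
    by (rule nn_integral_suminf) measurable
  also have "\<dots> = (\<Sum>k. ennreal (c ^ k) * emeasure M {\<omega>\<in>space M. N \<omega> = k})"
    by (intro suminf_cong nn_integral_cmult_indicator) measurable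
  also have "\<dots> = (\<Sum>k. ennreal ((l * c) ^ k / fact k * exp (- l)))"
    using c l by (intro suminf_cong)
      (simp add: emeasure_eq_measure law power_mult_distrib mult_ac flip: ennreal_mult)
  also have "\<dots> = ennreal (exp (l * c) * exp (- l))"
  proof (rule suminf_ennreal_eq)
    show "(\<lambda>k. (l * c) ^ k / fact k * exp (- l)) sums (exp (l * c) * exp (- l))"
      using exp_converges[of "l * c"] by (intro sums_mult2) (simp add: field_simps)
  qed (use c l in auto)
  finally have *: "(\<integral>\<^sup>+\<omega>. ennreal (c ^ N \<omega>) \<partial>M) = ennreal (exp (- (l * (1 - c))))"
    by (simp add: algebra_simps flip: exp_add)
  show ?thesis
    by (rule integral_eq_nn_integral[where f="\<lambda>\<omega>. c ^ N \<omega>", THEN trans]) (use c * in auto)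
qed

context
  fixes X :: "nat \<Rightarrow> 'a \<Rightarrow> plane"
  assumes X: "lebesgue_poisson_process X"
begin

lemma poisson_germ_measurable: "random_variable borel (X n)"
  using X by (simp add: lebesgue_poisson_process_def)

lemma poisson_locally_finite: "bounded A \<Longrightarrow> AE \<omega> in M. finite {n. X n \<omega> \<in> A}"
  using X by (simp add: lebesgue_poisson_process_def)

lemma poisson_count_indep:
  assumes "finite (I :: nat set)" "disjoint_family_on A I"
    "\<And>i. i \<in> I \<Longrightarrow> A i \<in> sets borel" "\<And>i. i \<in> I \<Longrightarrow> bounded (A i)"
  shows "indep_vars (\<lambda>_. count_space UNIV) (\<lambda>i. point_count X (A i)) I"
  using X assms by (simp add: lebesgue_poisson_process_def)

lemma poisson_count_measurable:
  assumes "A \<in> sets borel" "bounded A"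
  shows "random_variable (count_space UNIV) (point_count X A)"
  using poisson_count_indep[of "{0}" "\<lambda>_. A"] assms
  by (simp add: indep_vars_def disjoint_family_on_def)

text \<open>Counts in disjoint cells are independent, so the generating functions multiply. This is
  the Laplace functional for step functions.\<close>

lemma poisson_prod_power:
  assumes I: "finite (I :: nat set)" "disjoint_family_on A I"
    and A: "\<And>i. i \<in> I \<Longrightarrow> A i \<in> sets borel" "\<And>i. i \<in> I \<Longrightarrow> bounded (A i)"
    and c: "\<And>i. i \<in> I \<Longrightarrow> 0 \<le> c i" "\<And>i. i \<in> I \<Longrightarrow> c i \<le> 1"
  shows "integrable M (\<lambda>\<omega>. \<Prod>i\<in>I. c i ^ point_count X (A i) \<omega>)"
    and "expectation (\<lambda>\<omega>. \<Prod>i\<in>I. c i ^ point_count X (A i) \<omega>)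
           = exp (- (\<Sum>i\<in>I. measure lborel (A i) * (1 - c i)))"
proof -
  have ind: "indep_vars (\<lambda>_. borel) (\<lambda>i \<omega>. c i ^ point_count X (A i) \<omega>) I"
    by (rule indep_vars_compose2[OF poisson_count_indep[OF I A]]) auto
  have int: "integrable M (\<lambda>\<omega>. c i ^ point_count X (A i) \<omega>)" if "i \<in> I" for i
  proof (rule integrable_const_bound[where B=1])
    note [measurable] = poisson_count_measurable[OF A[OF that]]
    show "random_variable borel (\<lambda>\<omega>. c i ^ point_count X (A i) \<omega>)" by measurable
  qed (use c[OF that] in \<open>auto simp: power_le_one\<close>)
  show "integrable M (\<lambda>\<omega>. \<Prod>i\<in>I. c i ^ point_count X (A i) \<omega>)"
    by (rule indep_vars_integrable[OF I(1) ind int])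
  have "expectation (\<lambda>\<omega>. \<Prod>i\<in>I. c i ^ point_count X (A i) \<omega>)
      = (\<Prod>i\<in>I. expectation (\<lambda>\<omega>. c i ^ point_count X (A i) \<omega>))"
    by (rule indep_vars_lebesgue_integral[OF I(1) ind int])
  also have "\<dots> = (\<Prod>i\<in>I. exp (- (measure lborel (A i) * (1 - c i))))"
    using X A c
    by (intro prod.cong refl expectation_power_poisson poisson_count_measurable)
       (auto simp: lebesgue_poisson_process_def)
  also have "\<dots> = exp (- (\<Sum>i\<in>I. measure lborel (A i) * (1 - c i)))"
    by (simp add: exp_sum[OF I(1)] flip: sum_negf)
  finally show "expectation (\<lambda>\<omega>. \<Prod>i\<in>I. c i ^ point_count X (A i) \<omega>)
           = exp (- (\<Sum>i\<in>I. measure lborel (A i) * (1 - c i)))" .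
qed

text \<open>\<open>h\<close> plays the role of the infinite product of the \<open>1 - g (X n)\<close>.\<close>
lemma poisson_laplace:
  fixes g :: "plane \<Rightarrow> real"
  assumes A: "A \<in> sets borel" "bounded A"
    and g [measurable]: "g \<in> borel_measurable borel"
    and g01: "\<And>x. 0 \<le> g x" "\<And>x. g x \<le> 1"
    and h: "integrable M h"
      "AE \<omega> in M. h \<omega> = (\<Prod>n\<in>{n. X n \<omega> \<in> A}. 1 - g (X n \<omega>))"
  shows "expectation h = exp (- (\<integral>x\<in>A. g x \<partial>lborel))"
proof -
  note [measurable] = A(1)
  have fin: "emeasure lborel A < \<infinity>"
    using A(2) emeasure_bounded_finite by blast
  have gint: "set_integrable lborel A g"
    unfolding set_integrable_def
    by (rule integrableI_bounded_set_indicator[where B=1]) (use A(1) fin g01 in \<open>simp_all\<close>)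
  define a where "a = measure lborel A"
  \<comment> \<open>Step functions with levels in multiples of \<open>1 / k\<close> enclose
    \<open>1 - g\<close> on \<open>A\<close>. Rounding changes the exponent by at most
    \<open>a / k\<close>, which vanishes in the limit.\<close>
  have bounds: "exp (- (LINT x:A|lborel. g x) - a / k) \<le> expectation h \<and>
      expectation h \<le> exp (- (LINT x:A|lborel. g x) + a / k)" if k: "0 < k" for k :: nat
  proof -
    define lev where "lev x = nat \<lfloor>k * g x\<rfloor>" for x
    define L where "L j = {x\<in>A. lev x = j}" for j
    have lev_meas [measurable]: "lev \<in> borel \<rightarrow>\<^sub>M count_space UNIV" unfolding lev_def by measurable
    have lev_le: "lev x \<le> k" for x
    proof -
      have "real k * g x \<le> real k * 1" by (intro mult_left_mono g01) auto
      then show ?thesis unfolding lev_def by linarith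
    qed
    have lev_eq: "real (lev x) = of_int \<lfloor>k * g x\<rfloor>" for x
      unfolding lev_def using g01[of x] by simp
    have lev_lo: "lev x / k \<le> g x" and lev_hi: "g x \<le> (lev x + 1) / k" for x
      using k by (auto simp: lev_eq field_simps) linarith+
    have L_meas [measurable]: "L j \<in> sets borel" for j unfolding L_def by measurable
    have L_bdd: "bounded (L j)" for j using A(2) by (rule bounded_subset) (auto simp: L_def)
    have disj: "disjoint_family_on L {..k}" by (auto simp: disjoint_family_on_def L_def)
    have A_eq: "A = (\<Union>j\<le>k. L j)" using lev_le by (auto simp: L_def)
    have L_fin: "emeasure lborel (L j) < \<infinity>" for j
      using L_bdd emeasure_bounded_finite by blast
    have sub: "L j \<subseteq> A" for j by (auto simp: L_def)
    have L_int: "set_integrable lborel (L j) g" for j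
      by (rule set_integrable_subset[OF gint _ sub]) simp
    have const: "(LINT x:L j|lborel. c) = measure lborel (L j) * c" for j and c :: real
      by (simp add: set_lebesgue_integral_def)
    have a_sum: "a = (\<Sum>j\<le>k. measure lborel (L j))" unfolding a_def
      by (subst A_eq, rule measure_finite_Union) (use disj L_fin in \<open>auto simp: less_top\<close>)
    have int_sum: "(LINT x:A|lborel. g x) = (\<Sum>j\<le>k. LINT x:L j|lborel. g x)"
      by (subst A_eq, rule set_integral_finite_Union)
         (use disj L_int in simp_all)
    \<comment> \<open>Sorting the germs in \<open>A\<close> by level turns a product over germs into
      a product of powers of counts in disjoint cells.\<close>
    have group: "(\<Prod>n\<in>{n. X n \<omega> \<in> A}. f (lev (X n \<omega>))) = (\<Prod>j\<le>k. f j ^ point_count X (L j) \<omega>)"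
      if "finite {n. X n \<omega> \<in> A}" for \<omega> and f :: "nat \<Rightarrow> real"
    proof -
      have "(\<Prod>n\<in>{n. X n \<omega> \<in> A}. f (lev (X n \<omega>)))
          = (\<Prod>j\<le>k. \<Prod>n\<in>{n \<in> {n. X n \<omega> \<in> A}. lev (X n \<omega>) = j}. f (lev (X n \<omega>)))"
        by (rule prod.group[symmetric]) (use that lev_le in auto)
      also have "\<dots> = (\<Prod>j\<le>k. f j ^ point_count X (L j) \<omega>)"
        by (intro prod.cong refl) (simp add: point_count_def L_def)
      finally show ?thesis .
    qed
    \<comment> \<open>Level \<open>k\<close> occurs exactly where \<open>g\<close> equals 1. There
      the general formula would give \<open>- 1 / k\<close>, and monotonicity of products needs
      nonnegative factors.\<close>
    define lo where "lo j = (if j = k then 0 else 1 - real (j + 1) / k)" for j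
    define hi where "hi j = 1 - real j / k" for j
    have lo01: "0 \<le> lo j" "lo j \<le> 1" and hi01: "0 \<le> hi j" "hi j \<le> 1" if "j \<le> k" for j
      using that k by (auto simp: lo_def hi_def field_simps)
    have lo_le: "lo (lev x) \<le> 1 - g x" and le_hi: "1 - g x \<le> hi (lev x)" for x
      using lev_lo[of x] lev_hi[of x] g01[of x] by (auto simp: lo_def hi_def add.commute)
    have "expectation (\<lambda>\<omega>. \<Prod>j\<le>k. lo j ^ point_count X (L j) \<omega>) \<le> expectation h"
    proof (rule integral_mono_AE[OF poisson_prod_power(1) h(1)])
      show "AE \<omega> in M. (\<Prod>j\<le>k. lo j ^ point_count X (L j) \<omega>) \<le> h \<omega>"
        using h(2) poisson_locally_finite[OF A(2)]
      proof eventually_elim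
        case (elim \<omega>)
        show ?case unfolding elim(1) group[OF elim(2), symmetric]
          by (intro prod_mono conjI lo01 lo_le lev_le)
      qed
    qed (use disj lo01 L_bdd in auto)
    moreover have "expectation h \<le> expectation (\<lambda>\<omega>. \<Prod>j\<le>k. hi j ^ point_count X (L j) \<omega>)"
    proof (rule integral_mono_AE[OF h(1) poisson_prod_power(1)])
      show "AE \<omega> in M. h \<omega> \<le> (\<Prod>j\<le>k. hi j ^ point_count X (L j) \<omega>)"
        using h(2) poisson_locally_finite[OF A(2)]
      proof eventually_elim
        case (elim \<omega>)
        show ?case unfolding elim(1) group[OF elim(2), symmetric]
          by (intro prod_mono conjI le_hi) (use g01 in auto)
      qed
    qed (use disj hi01 L_bdd in auto)
    moreover have "expectation (\<lambda>\<omega>. \<Prod>j\<le>k. lo j ^ point_count X (L j) \<omega>)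
        = exp (- (\<Sum>j\<le>k. measure lborel (L j) * (1 - lo j)))"
      by (rule poisson_prod_power(2)) (use disj lo01 L_bdd in auto)
    moreover have "expectation (\<lambda>\<omega>. \<Prod>j\<le>k. hi j ^ point_count X (L j) \<omega>)
        = exp (- (\<Sum>j\<le>k. measure lborel (L j) * (1 - hi j)))"
      by (rule poisson_prod_power(2)) (use disj hi01 L_bdd in auto)
    moreover have "(\<Sum>j\<le>k. measure lborel (L j) * (1 - lo j)) \<le> (LINT x:A|lborel. g x) + a / k"
    proof -
      have "measure lborel (L j) * (1 - lo j) \<le> (LINT x:L j|lborel. g x) + measure lborel (L j) / k"
        if "j \<le> k" for j
      proof -
        have "(LINT x:L j|lborel. 1 - lo j - 1 / k) \<le> (LINT x:L j|lborel. g x)"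
        proof (rule set_integral_mono)
          show "set_integrable lborel (L j) (\<lambda>x. 1 - lo j - 1 / k)"
            using L_fin[of j] by (simp add: set_integrable_def)
          show "set_integrable lborel (L j) g" by (rule L_int)
          show "1 - lo j - 1 / k \<le> g x" if "x \<in> L j" for x
            using lev_lo[of x] that k by (auto simp: L_def lo_def field_simps split: if_splits)
        qed
        then show ?thesis by (simp add: const algebra_simps)
      qed
      then have "(\<Sum>j\<le>k. measure lborel (L j) * (1 - lo j))
          \<le> (\<Sum>j\<le>k. (LINT x:L j|lborel. g x) + measure lborel (L j) / k)"
        by (intro sum_mono) auto
      then show ?thesis by (simp add: int_sum a_sum sum.distrib sum_divide_distrib)
    qed
    moreover have "(LINT x:A|lborel. g x) - a / k \<le> (\<Sum>j\<le>k. measure lborel (L j) * (1 - hi j))"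
    proof -
      have "(LINT x:L j|lborel. g x) - measure lborel (L j) / k \<le> measure lborel (L j) * (1 - hi j)"
        if "j \<le> k" for j
      proof -
        have "(LINT x:L j|lborel. g x) \<le> (LINT x:L j|lborel. 1 - hi j + 1 / k)"
        proof (rule set_integral_mono)
          show "set_integrable lborel (L j) (\<lambda>x. 1 - hi j + 1 / k)"
            using L_fin[of j] by (simp add: set_integrable_def)
          show "set_integrable lborel (L j) g" by (rule L_int)
          show "g x \<le> 1 - hi j + 1 / k" if "x \<in> L j" for x
            using lev_hi[of x] that k by (auto simp: L_def hi_def add_divide_distrib)
        qed
        then show ?thesis by (simp add: const algebra_simps)
      qed
      then have "(\<Sum>j\<le>k. (LINT x:L j|lborel. g x) - measure lborel (L j) / k)
          \<le> (\<Sum>j\<le>k. measure lborel (L j) * (1 - hi j))"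
        by (intro sum_mono) auto
      then show ?thesis by (simp add: int_sum a_sum sum_subtractf sum_divide_distrib)
    qed
    ultimately show ?thesis
      by (smt (verit) exp_le_cancel_iff)
  qed
  have lim: "(\<lambda>k. a / real (Suc k)) \<longlonglongrightarrow> 0"
    using tendsto_mult[OF tendsto_const[of a] LIMSEQ_inverse_real_of_nat] by (simp add: divide_inverse)
  have "(\<lambda>k. exp (- (LINT x:A|lborel. g x) - a / Suc k)) \<longlonglongrightarrow> exp (- (LINT x:A|lborel. g x) - 0)"
    by (intro tendsto_intros lim)
  then have "exp (- (LINT x:A|lborel. g x) - 0) \<le> expectation h"
    by (rule LIMSEQ_le_const2) (use bounds in \<open>simp del: of_nat_Suc\<close>)
  moreover have "(\<lambda>k. exp (- (LINT x:A|lborel. g x) + a / Suc k)) \<longlonglongrightarrow> exp (- (LINT x:A|lborel. g x) + 0)"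
    by (intro tendsto_intros lim)
  then have "expectation h \<le> exp (- (LINT x:A|lborel. g x) + 0)"
    by (rule LIMSEQ_le_const) (use bounds in \<open>simp del: of_nat_Suc\<close>)
  ultimately show ?thesis by simp
qed

end

end

section \<open>Directions and shadows in the plane\<close>

definition dir :: "real \<Rightarrow> plane" where
  "dir \<theta> = vector [cos \<theta>, sin \<theta>]"

definition rot :: "real \<Rightarrow> plane \<Rightarrow> plane" where
  "rot \<theta> x = (x $ 1) *\<^sub>R dir \<theta> + (x $ 2) *\<^sub>R dir (\<theta> + pi / 2)"

text \<open>The clause \<open>\<rho> < norm x\<close> discards discs that cover the origin. It keeps
  the class disjoint from the marks excluded by the conditioning.\<close>

definition shadowing :: "real \<Rightarrow> plane \<Rightarrow> (plane \<times> real) set" where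
  "shadowing r u = {(x, \<rho>). \<rho> < norm x \<and> (\<exists>s. 0 \<le> s \<and> s \<le> r \<and> s *\<^sub>R u \<in> cball x \<rho>)}"

lemma dir_nth [simp]: "dir \<theta> $ 1 = cos \<theta>" "dir \<theta> $ 2 = sin \<theta>"
  by (simp_all add: dir_def)

lemma rot_nth [simp]:
  "rot \<theta> x $ 1 = x $ 1 * cos \<theta> - x $ 2 * sin \<theta>"
  "rot \<theta> x $ 2 = x $ 1 * sin \<theta> + x $ 2 * cos \<theta>"
  by (simp_all add: rot_def cos_add sin_add)

lemma plane_eq_iff: "x = y \<longleftrightarrow> x $ 1 = y $ 1 \<and> x $ 2 = y $ 2" for x y :: plane
  by (simp add: vec_eq_iff forall_2)

lemma inner_plane: "x \<bullet> y = x $ 1 * y $ 1 + x $ 2 * y $ 2" for x y :: plane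
  by (simp add: inner_vec_def sum_2)

lemma norm_plane: "norm x = sqrt ((x $ 1)\<^sup>2 + (x $ 2)\<^sup>2)" for x :: plane
  by (simp add: norm_eq_sqrt_inner inner_plane power2_eq_square)

lemma norm_dir [simp]: "norm (dir \<theta>) = 1"
  by (simp add: norm_plane)

lemma norm_1_imp_dir:
  fixes u :: plane
  assumes "norm u = 1"
  obtains \<theta> where "0 \<le> \<theta>" "\<theta> < 2 * pi" "u = dir \<theta>"
proof -
  have "(u $ 1)\<^sup>2 + (u $ 2)\<^sup>2 = 1" using assms by (simp add: norm_plane)
  then obtain \<theta> where "0 \<le> \<theta>" "\<theta> < 2 * pi" "u $ 1 = cos \<theta>" "u $ 2 = sin \<theta>"
    using sincos_total_2pi[of "u $ 1" "u $ 2"] by metis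
  then show thesis using that by (simp add: plane_eq_iff)
qed

section \<open>Rotations and the invariance of Lebesgue measure\<close>

lemma linear_rot: "linear (rot \<theta>)"
  by (rule linearI) (simp_all add: plane_eq_iff algebra_simps)

lemma norm_rot [simp]: "norm (rot \<theta> x) = norm x"
proof -
  have "(x $ 1 * cos \<theta> - x $ 2 * sin \<theta>)\<^sup>2 + (x $ 1 * sin \<theta> + x $ 2 * cos \<theta>)\<^sup>2
      = ((x $ 1)\<^sup>2 + (x $ 2)\<^sup>2) * ((cos \<theta>)\<^sup>2 + (sin \<theta>)\<^sup>2)"
    by (simp only: power2_eq_square) algebra
  then show ?thesis by (simp add: norm_plane)
qed

lemma orthogonal_transformation_rot: "orthogonal_transformation (rot \<theta>)"
  by (simp add: orthogonal_transformation linear_rot)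

lemma rot_dir: "rot \<theta> (dir \<phi>) = dir (\<theta> + \<phi>)"
  by (simp add: plane_eq_iff cos_add sin_add)

lemma rot_add: "rot \<theta> (rot \<phi> x) = rot (\<theta> + \<phi>) x"
  by (simp add: plane_eq_iff cos_add sin_add algebra_simps)

lemma rot_0 [simp]: "rot 0 x = x"
  by (simp add: plane_eq_iff)

lemma continuous_on_dir [continuous_intros]:
  fixes f :: "'a::t2_space \<Rightarrow> real"
  shows "continuous_on S f \<Longrightarrow> continuous_on S (\<lambda>x. dir (f x))"
  unfolding continuous_on_def
proof (intro ballI vec_tendstoI)
  fix x i
  assume "\<forall>x\<in>S. (f \<longlongrightarrow> f x) (at x within S)" "x \<in> S"
  then have "(f \<longlongrightarrow> f x) (at x within S)" by blast
  from tendsto_cos[OF this] tendsto_sin[OF this]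
  show "((\<lambda>x. dir (f x) $ i) \<longlongrightarrow> dir (f x) $ i) (at x within S)"
    using exhaust_2[of i] by auto
qed

lemma borel_measurable_dir [measurable]: "dir \<in> borel_measurable borel"
  by (intro borel_measurable_continuous_onI continuous_intros)

lemma borel_measurable_rot [measurable]: "rot \<theta> \<in> borel_measurable borel"
  by (intro borel_measurable_continuous_onI linear_continuous_on linear_conv_bounded_linear[THEN iffD1] linear_rot)

lemma distr_lborel_rot: "distr lborel borel (rot \<theta>) = (lborel :: plane measure)"
proof (rule lborel_eqI[symmetric])
  fix l u :: plane
  assume lu: "\<And>b. b \<in> Basis \<Longrightarrow> l \<bullet> b \<le> u \<bullet> b"
  have pre: "rot \<theta> -` box l u = rot (- \<theta>) ` box l u"
    by (auto simp: rot_add image_iff intro!: bexI[of _ "rot \<theta> _"])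
  have "emeasure (distr lborel borel (rot \<theta>)) (box l u) = emeasure lborel (rot (- \<theta>) ` box l u)"
    by (simp add: emeasure_distr pre)
  also have "\<dots> = ennreal (measure lborel (rot (- \<theta>) ` box l u))"
  proof (rule emeasure_eq_ennreal_measure)
    have "bounded (rot (- \<theta>) ` box l u)"
      by (intro bounded_linear_image bounded_box linear_conv_bounded_linear[THEN iffD1] linear_rot)
    then show "emeasure lborel (rot (- \<theta>) ` box l u) \<noteq> top"
      using emeasure_bounded_finite by fastforce
  qed
  also have "measure lborel (rot (- \<theta>) ` box l u) = measure lebesgue (rot (- \<theta>) ` box l u)"
  proof -
    have "rot \<theta> -` box l u \<in> sets borel"
      using measurable_sets[OF borel_measurable_rot, of "box l u"] by simp
    then show ?thesis by (simp add: pre)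
  qed
  also have "\<dots> = measure lebesgue (box l u)"
    by (rule measure_orthogonal_image[OF orthogonal_transformation_rot]) simp
  also have "ennreal \<dots> = emeasure lborel (box l u)"
    using emeasure_bounded_finite[OF bounded_box, of l u]
    by (simp add: emeasure_eq_ennreal_measure less_top)
  finally show "emeasure (distr lborel borel (rot \<theta>)) (box l u) = (\<Prod>b\<in>Basis. (u - l) \<bullet> b)"
    using lu by (simp add: emeasure_lborel_box)
qed simp

lemma emeasure_lborel_rot_vimage:
  "S \<in> sets borel \<Longrightarrow> emeasure lborel (rot \<theta> -` S) = emeasure lborel (S :: plane set)"
  by (subst (2) distr_lborel_rot[of \<theta>, symmetric]) (simp add: emeasure_distr)

section \<open>Shadows as arcs: comparison of inner products with the germ\<close>

lemma norm_scale_diff_sq: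
  fixes u x :: "'a::real_inner"
  assumes "norm u = 1"
  shows "(norm (s *\<^sub>R u - x))\<^sup>2 = (norm x)\<^sup>2 - 2 * s * (u \<bullet> x) + s\<^sup>2"
  using assms unfolding power2_norm_eq_inner
  by (simp add: inner_diff_left inner_diff_right inner_commute norm_eq_1 power2_eq_square)

text \<open>The disc contains a point of the ray but not the origin, so that point is closer to the
  centre than the origin is; expanding the squared distances gives the sign.\<close>

lemma shadowing_inner_pos:
  assumes "(x, \<rho>) \<in> shadowing r u" "norm u = 1"
  shows "0 < u \<bullet> x"
proof -
  obtain s where s: "\<rho> < norm x" "0 \<le> s" "norm (s *\<^sub>R u - x) \<le> \<rho>"
    using assms(1) by (auto simp: shadowing_def dist_norm norm_minus_commute)
  then have "(norm (s *\<^sub>R u - x))\<^sup>2 < (norm x)\<^sup>2"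
    by (intro power_strict_mono) auto
  then have "s\<^sup>2 < 2 * (s * (u \<bullet> x))"
    by (simp add: norm_scale_diff_sq[OF assms(2)] mult.assoc)
  then have "0 < s * (u \<bullet> x)"
    using zero_le_power2[of s] by linarith
  then show ?thesis using s(2) by (simp add: zero_less_mult_iff)
qed

text \<open>For fixed \<open>s\<close>, the distance from the point at distance \<open>s\<close> in
  direction \<open>u\<close> to the centre depends on \<open>u\<close> only through
  \<open>u \<bullet> x\<close>, and decreases in it. A shadow is therefore a cap around the
  direction of the germ.\<close>

lemma shadowing_mono_inner:
  assumes "(x, \<rho>) \<in> shadowing r u" "norm u = 1" "norm v = 1" "u \<bullet> x \<le> v \<bullet> x"
  shows "(x, \<rho>) \<in> shadowing r v"
proof -
  obtain s where s: "\<rho> < norm x" "0 \<le> s" "s \<le> r" "norm (s *\<^sub>R u - x) \<le> \<rho>"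
    using assms(1) by (auto simp: shadowing_def dist_norm norm_minus_commute)
  have "s * (u \<bullet> x) \<le> s * (v \<bullet> x)" using s(2) assms(4) by (rule mult_left_mono[rotated])
  then have "(norm (s *\<^sub>R v - x))\<^sup>2 \<le> (norm (s *\<^sub>R u - x))\<^sup>2"
    unfolding norm_scale_diff_sq[OF assms(2)] norm_scale_diff_sq[OF assms(3)] by simp
  then have "norm (s *\<^sub>R v - x) \<le> norm (s *\<^sub>R u - x)" by (rule power2_le_imp_le) simp
  then show ?thesis using s
    by (auto simp: shadowing_def dist_norm norm_minus_commute intro!: exI[of _ s])
qed

text \<open>Written with the explicit nearest point of the segment, the condition is visibly closed.\<close>
lemma segment_meets_cball_iff:
  fixes u x :: "'a::real_inner"
  assumes "norm u = 1" "0 \<le> r"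
  shows "(\<exists>s. 0 \<le> s \<and> s \<le> r \<and> s *\<^sub>R u \<in> cball x \<rho>)
    \<longleftrightarrow> norm (max 0 (min r (u \<bullet> x)) *\<^sub>R u - x) \<le> \<rho>"
proof
  assume "\<exists>s. 0 \<le> s \<and> s \<le> r \<and> s *\<^sub>R u \<in> cball x \<rho>"
  then obtain s where s: "0 \<le> s" "s \<le> r" "norm (s *\<^sub>R u - x) \<le> \<rho>"
    by (auto simp: dist_norm norm_minus_commute)
  define t where "t = max 0 (min r (u \<bullet> x))"
  have "(t - u \<bullet> x)\<^sup>2 \<le> (s - u \<bullet> x)\<^sup>2"
    unfolding t_def using s assms(2) by (intro abs_le_square_iff[THEN iffD1]) auto
  then have "(norm (t *\<^sub>R u - x))\<^sup>2 \<le> (norm (s *\<^sub>R u - x))\<^sup>2"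
    unfolding norm_scale_diff_sq[OF assms(1)] by (simp add: power2_eq_square algebra_simps)
  then have "norm (t *\<^sub>R u - x) \<le> norm (s *\<^sub>R u - x)" by (rule power2_le_imp_le) simp
  then show "norm (max 0 (min r (u \<bullet> x)) *\<^sub>R u - x) \<le> \<rho>"
    using s by (simp add: t_def)
next
  assume "norm (max 0 (min r (u \<bullet> x)) *\<^sub>R u - x) \<le> \<rho>"
  then show "\<exists>s. 0 \<le> s \<and> s \<le> r \<and> s *\<^sub>R u \<in> cball x \<rho>" using assms(2)
    by (auto simp: dist_norm norm_minus_commute intro!: exI[of _ "max 0 (min r (u \<bullet> x))"])
qed

lemma shadowing_iff_clamp:
  assumes "norm u = 1" "0 \<le> r"
  shows "(x, \<rho>) \<in> shadowing r u \<longleftrightarrow>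
    \<rho> < norm x \<and> norm (max 0 (min r (u \<bullet> x)) *\<^sub>R u - x) \<le> \<rho>"
  using segment_meets_cball_iff[OF assms] by (simp add: shadowing_def)

lemma shadowing_measurable [measurable]:
  assumes "norm u = 1" "0 \<le> r"
  shows "shadowing r u \<in> sets (borel \<Otimes>\<^sub>M borel)"
proof -
  have "shadowing r u = {z \<in> space (borel \<Otimes>\<^sub>M borel). snd z < norm (fst z) \<and>
      norm (max 0 (min r (u \<bullet> fst z)) *\<^sub>R u - fst z) \<le> snd z}"
    using shadowing_iff_clamp[OF assms] by (auto simp: space_pair_measure)
  then show ?thesis by simp
qed

lemma shadowing_norm_le:
  assumes "(x, \<rho>) \<in> shadowing r u" "norm u = 1"
  shows "norm x \<le> r + \<rho>"
proof -
  obtain s where s: "0 \<le> s" "s \<le> r" "norm (s *\<^sub>R u - x) \<le> \<rho>"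
    using assms(1) by (auto simp: shadowing_def dist_norm norm_minus_commute)
  then show ?thesis
    using norm_triangle_sub[of x "s *\<^sub>R u"] assms(2) by (simp add: norm_minus_commute)
qed

lemma shadowing_rot:
  "(rot \<theta> x, \<rho>) \<in> shadowing r (dir (\<theta> + \<phi>)) \<longleftrightarrow> (x, \<rho>) \<in> shadowing r (dir \<phi>)"
proof -
  have "s *\<^sub>R dir (\<theta> + \<phi>) \<in> cball (rot \<theta> x) \<rho> \<longleftrightarrow> s *\<^sub>R dir \<phi> \<in> cball x \<rho>" for s
  proof -
    have "s *\<^sub>R dir (\<theta> + \<phi>) = rot \<theta> (s *\<^sub>R dir \<phi>)"
      by (simp add: rot_dir linear_scale[OF linear_rot])
    then have "dist (rot \<theta> x) (s *\<^sub>R dir (\<theta> + \<phi>)) = dist x (s *\<^sub>R dir \<phi>)"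
      by (simp add: dist_norm flip: linear_diff[OF linear_rot])
    then show ?thesis by simp
  qed
  then show ?thesis by (simp add: shadowing_def)
qed

text \<open>An intermediate direction is a combination of the two ends with coefficients
  \<open>a\<close> and \<open>b\<close>, nonnegative because the angle is below pi, and with
  \<open>1 \<le> a + b\<close> by the triangle inequality. As both inner products with the germ are
  positive, the intermediate one is at least the smaller of them.\<close>

lemma shadowing_between:
  assumes "\<alpha> \<le> \<theta>" "\<theta> \<le> \<beta>" "\<beta> - \<alpha> < pi"
    and "(x, \<rho>) \<in> shadowing r (dir \<alpha>)" "(x, \<rho>) \<in> shadowing r (dir \<beta>)"
  shows "(x, \<rho>) \<in> shadowing r (dir \<theta>)"
proof (cases "\<alpha> = \<beta>")
  case False
  then have pos: "0 < sin (\<beta> - \<alpha>)" using assms by (intro sin_gt_zero) auto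
  define a where "a = sin (\<beta> - \<theta>) / sin (\<beta> - \<alpha>)"
  define b where "b = sin (\<theta> - \<alpha>) / sin (\<beta> - \<alpha>)"
  have ab: "0 \<le> a" "0 \<le> b"
    unfolding a_def b_def using pos assms by (auto intro!: divide_nonneg_pos sin_ge_zero)
  have "sin (\<beta> - \<alpha>) *\<^sub>R dir \<theta> = sin (\<beta> - \<theta>) *\<^sub>R dir \<alpha> + sin (\<theta> - \<alpha>) *\<^sub>R dir \<beta>"
    by (simp add: plane_eq_iff sin_diff algebra_simps)
  moreover have "dir \<theta> = inverse (sin (\<beta> - \<alpha>)) *\<^sub>R sin (\<beta> - \<alpha>) *\<^sub>R dir \<theta>"
    using pos by simp
  ultimately have eq: "dir \<theta> = a *\<^sub>R dir \<alpha> + b *\<^sub>R dir \<beta>"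
    by (simp add: a_def b_def scaleR_add_right divide_inverse mult.commute)
  have "1 \<le> a + b"
    using norm_triangle_ineq[of "a *\<^sub>R dir \<alpha>" "b *\<^sub>R dir \<beta>"] ab by (simp flip: eq)
  define m where "m = min (dir \<alpha> \<bullet> x) (dir \<beta> \<bullet> x)"
  have "0 < m" using shadowing_inner_pos assms by (simp add: m_def)
  then have "m \<le> (a + b) * m" using \<open>1 \<le> a + b\<close> by simp
  also have "\<dots> \<le> a * (dir \<alpha> \<bullet> x) + b * (dir \<beta> \<bullet> x)"
    unfolding distrib_right using ab by (intro add_mono mult_left_mono) (auto simp: m_def)
  also have "\<dots> = dir \<theta> \<bullet> x" by (simp add: eq inner_add_left)
  finally have "dir \<alpha> \<bullet> x \<le> dir \<theta> \<bullet> x \<or> dir \<beta> \<bullet> x \<le> dir \<theta> \<bullet> x"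
    by (auto simp: m_def min_def split: if_splits)
  then show ?thesis using shadowing_mono_inner assms(4,5) norm_dir by blast
qed (use assms in auto)

text \<open>The last factor is the component of the germ along a normal of the bisector of the two
  directions, and depends on the angles only through their sum. Two pairs with the same sum can thus
  be compared.\<close>

lemma dir_inner_diff:
  "dir \<alpha> \<bullet> x - dir \<beta> \<bullet> x
     = 2 * sin ((\<beta> - \<alpha>) / 2) * (x $ 1 * sin ((\<alpha> + \<beta>) / 2) - x $ 2 * cos ((\<alpha> + \<beta>) / 2))"
proof -
  have "dir \<alpha> \<bullet> x - dir \<beta> \<bullet> x = x $ 1 * (cos \<alpha> - cos \<beta>) + x $ 2 * (sin \<alpha> - sin \<beta>)"
    by (simp add: inner_plane algebra_simps)
  also have "sin ((\<alpha> - \<beta>) / 2) = - sin ((\<beta> - \<alpha>) / 2)"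
    by (metis minus_diff_eq minus_divide_left sin_minus)
  ultimately show ?thesis
    by (simp add: cos_diff_cos sin_diff_sin algebra_simps)
qed

text \<open>Each shadow is an arc, so walking once around the circle one leaves it at most once.\<close>
lemma disjoint_shadowing_exits:
  fixes K :: nat and \<delta> :: real
  defines "\<delta> \<equiv> 2 * pi / K"
  shows "disjoint_family_on
    (\<lambda>j. shadowing r (dir (j * \<delta>)) - shadowing r (dir (Suc j * \<delta>))) {..<K}"
proof -
  have False if ij: "i < j" "j < K"
    and i: "(x, \<rho>) \<in> shadowing r (dir (i * \<delta>))" "(x, \<rho>) \<notin> shadowing r (dir (Suc i * \<delta>))"
    and j: "(x, \<rho>) \<in> shadowing r (dir (j * \<delta>))" "(x, \<rho>) \<notin> shadowing r (dir (Suc j * \<delta>))"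
    for i j x \<rho>
  proof -
    \<comment> \<open>Directions outside a shadow have a smaller inner product with the germ than
      directions inside. The crossed pairs \<open>i, Suc j\<close> and \<open>j, Suc i\<close> are
      chosen because their angles have the same sum: both differences contain the factor
      \<open>c\<close>, positive by the first pair and impossible by the second.\<close>
    have gt: "dir (Suc j * \<delta>) \<bullet> x < dir (i * \<delta>) \<bullet> x" "dir (Suc i * \<delta>) \<bullet> x < dir (j * \<delta>) \<bullet> x"
      using shadowing_mono_inner i j norm_dir not_le by blast+
    define c where "c = x $ 1 * sin ((i + j + 1) * \<delta> / 2) - x $ 2 * cos ((i + j + 1) * \<delta> / 2)"
    have K: "0 < real K" using ij by simp
    have "0 < dir (i * \<delta>) \<bullet> x - dir (Suc j * \<delta>) \<bullet> x" using gt by simp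
    also have "\<dots> = 2 * sin ((real j + 1 - real i) * \<delta> / 2) * c"
      unfolding dir_inner_diff c_def by (simp add: algebra_simps)
    finally have 1: "0 < sin ((real j + 1 - real i) * \<delta> / 2) * c" by (simp add: mult.commute)
    have "0 \<le> sin ((real j + 1 - real i) * \<delta> / 2)"
    proof (rule sin_ge_zero)
      show "0 \<le> (real j + 1 - real i) * \<delta> / 2" using ij by (simp add: \<delta>_def)
      have "(real j + 1 - real i) * pi \<le> real K * pi" using ij by (intro mult_right_mono) auto
      then show "(real j + 1 - real i) * \<delta> / 2 \<le> pi" using K by (simp add: \<delta>_def field_simps)
    qed
    with 1 have "0 < c" by (simp add: zero_less_mult_iff)
    have "0 < dir (j * \<delta>) \<bullet> x - dir (Suc i * \<delta>) \<bullet> x" using gt by simp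
    also have "\<dots> = - (2 * sin ((real j - (real i + 1)) * \<delta> / 2) * c)"
    proof -
      have "dir (j * \<delta>) \<bullet> x - dir (Suc i * \<delta>) \<bullet> x = - (dir (Suc i * \<delta>) \<bullet> x - dir (j * \<delta>) \<bullet> x)"
        by simp
      then show ?thesis unfolding dir_inner_diff c_def by (simp add: algebra_simps)
    qed
    finally have 2: "sin ((real j - (real i + 1)) * \<delta> / 2) * c < 0" by (simp add: mult.commute)
    have "0 \<le> sin ((real j - (real i + 1)) * \<delta> / 2)"
    proof (rule sin_ge_zero)
      show "0 \<le> (real j - (real i + 1)) * \<delta> / 2" using ij by (simp add: \<delta>_def)
      have "(real j - (real i + 1)) * pi \<le> real K * pi" using ij by (intro mult_right_mono) auto
      then show "(real j - (real i + 1)) * \<delta> / 2 \<le> pi" using K by (simp add: \<delta>_def field_simps)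
    qed
    with 2 \<open>0 < c\<close> show False by (simp add: mult_less_0_iff)
  qed
  then show ?thesis
    unfolding disjoint_family_on_def by (auto, metis nat_neq_iff)
qed

section \<open>Areas\<close>

lemma area_cball_plane:
  "0 \<le> \<rho> \<Longrightarrow> emeasure lborel (cball (x :: plane) \<rho>) = ennreal (pi * \<rho>\<^sup>2)"
  by (simp add: emeasure_cball unit_ball_vol_2)

lemma area_annulus:
  assumes "0 \<le> \<rho>" "0 \<le> r"
  shows "emeasure lborel {x :: plane. \<rho> < norm x \<and> norm x \<le> \<rho> + r} = ennreal (pi * (2 * r * \<rho> + r\<^sup>2))"
proof -
  have "{x :: plane. \<rho> < norm x \<and> norm x \<le> \<rho> + r} = cball 0 (\<rho> + r) - cball 0 \<rho>" by auto
  also have "emeasure lborel (cball 0 (\<rho> + r) - cball 0 \<rho> :: plane set)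
      = emeasure lborel (cball 0 (\<rho> + r) :: plane set) - emeasure lborel (cball 0 \<rho> :: plane set)"
    using assms by (intro emeasure_Diff) (auto simp: area_cball_plane)
  also have "\<dots> = ennreal (pi * (\<rho> + r)\<^sup>2 - pi * \<rho>\<^sup>2)"
    using assms by (simp add: area_cball_plane ennreal_minus)
  finally show ?thesis by (simp add: power2_eq_square algebra_simps)
qed

lemma area_rectangle:
  assumes "a \<le> a'" "b \<le> b'"
  shows "emeasure lborel (cbox (vector [a, b]) (vector [a', b']) :: plane set) = ennreal ((a' - a) * (b' - b))"
proof -
  have "emeasure lborel (cbox (vector [a, b]) (vector [a', b']) :: plane set)
      = ennreal (measure lborel (cbox (vector [a, b]) (vector [a', b']) :: plane set))"
    by (intro emeasure_eq_ennreal_measure less_top[THEN iffD2])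
       (use emeasure_bounded_finite[OF bounded_cbox] in simp)
  also have "measure lborel (cbox (vector [a, b]) (vector [a', b']) :: plane set) = (a' - a) * (b' - b)"
    using assms by (subst content_cbox_cart)
      (auto simp: UNIV_2 interval_ne_empty_cart forall_2)
  finally show ?thesis .
qed

text \<open>The stadium around the segment is a disc cut in two halves with a rectangle inserted.\<close>
lemma area_shadowing:
  assumes "0 < \<rho>" "0 \<le> r"
  shows "emeasure lborel {x. (x, \<rho>) \<in> shadowing r (dir 0)} = ennreal (2 * r * \<rho>)"
proof -
  define e where "e = (vector [1, 0] :: plane)"
  have dir0: "dir 0 = e" by (simp add: dir_def e_def)
  have e_nth: "e $ 1 = 1" "e $ 2 = 0" by (simp_all add: e_def)
  define Z where "Z = {x. (x, \<rho>) \<in> shadowing r (dir 0)}"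
  define D where "D = cball (0 :: plane) \<rho>"
  define left where "left = D \<inter> {x. x $ 1 \<le> 0}"
  define right where "right = D \<inter> {x. 0 < x $ 1}"
  define right' where "right' = (\<lambda>x. x - r *\<^sub>R e) -` right"
  define box0 where "box0 = (cbox (vector [0, - \<rho>]) (vector [r, \<rho>]) :: plane set)"
  \<comment> \<open>The half disc \<open>left\<close> already contains this side of the rectangle.
    It has area 0 and is removed to make the pieces disjoint.\<close>
  define edge where "edge = (cbox (vector [0, - \<rho>]) (vector [0, \<rho>]) :: plane set)"
  have [measurable]: "D \<in> sets borel" "box0 \<in> sets borel" "edge \<in> sets borel"
    by (simp_all add: D_def box0_def edge_def)
  have [measurable]: "left \<in> sets borel" "right \<in> sets borel"
    unfolding left_def right_def by measurable
  have [measurable]: "right' \<in> sets borel"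
    unfolding right'_def by (rule measurable_sets_borel[of _ borel]) measurable
  have Z_meas [measurable]: "Z \<in> sets borel"
    using sets_Pair2[OF shadowing_measurable[of "dir 0" r], of \<rho>] assms
    by (simp add: Z_def vimage_def)
  have nrm: "norm x \<le> \<rho> \<longleftrightarrow> (x $ 1)\<^sup>2 + (x $ 2)\<^sup>2 \<le> \<rho>\<^sup>2" for x :: plane
    using assms by (simp add: norm_plane real_sqrt_le_iff')
  have stadium: "Z \<union> D = (left \<union> (box0 - edge)) \<union> right'"
  proof (rule set_eqI)
    fix x :: plane
    define t where "t = max 0 (min r (x $ 1))"
    have zero: "(t - x $ 1)\<^sup>2 \<le> (0 - x $ 1)\<^sup>2"
      using assms by (intro abs_le_square_iff[THEN iffD1]) (auto simp: t_def)
    have "x \<in> Z \<longleftrightarrow> \<rho> < norm x \<and> norm (t *\<^sub>R e - x) \<le> \<rho>"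
      using shadowing_iff_clamp[of "dir 0" r x \<rho>] assms
      by (simp add: Z_def inner_plane t_def dir0[symmetric])
    moreover have "norm (t *\<^sub>R e - x) \<le> norm x"
      unfolding norm_plane using zero by (intro real_sqrt_le_mono) (simp add: e_nth)
    ultimately have "x \<in> Z \<union> D \<longleftrightarrow> norm (t *\<^sub>R e - x) \<le> \<rho>"
      unfolding D_def by auto
    also have "\<dots> \<longleftrightarrow> (t - x $ 1)\<^sup>2 + (x $ 2)\<^sup>2 \<le> \<rho>\<^sup>2" by (simp add: nrm e_nth)
    also have "\<dots> \<longleftrightarrow> x \<in> left \<union> (box0 - edge) \<union> right'"
    proof -
      consider "x $ 1 \<le> 0" | "0 < x $ 1" "x $ 1 \<le> r" | "0 < x $ 1" "r < x $ 1" by linarith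
      then show ?thesis
      proof cases
        case 2
        moreover have "(x $ 2)\<^sup>2 \<le> \<rho>\<^sup>2 \<longleftrightarrow> - \<rho> \<le> x $ 2 \<and> x $ 2 \<le> \<rho>"
          using abs_le_square_iff[of "x $ 2" \<rho>] assms by auto
        ultimately show ?thesis
          by (auto simp: t_def left_def right'_def right_def box0_def edge_def D_def
              mem_box_cart forall_2 e_nth)
      qed (use assms in \<open>auto simp: t_def left_def right'_def right_def box0_def edge_def D_def
              mem_box_cart forall_2 e_nth nrm power2_commute\<close>)
    qed
    finally show "x \<in> Z \<union> D \<longleftrightarrow> x \<in> left \<union> (box0 - edge) \<union> right'" .
  qed
  have D_area: "emeasure lborel D = ennreal (pi * \<rho>\<^sup>2)"
    unfolding D_def by (rule area_cball_plane) (use assms in simp)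
  have right': "emeasure lborel right' = emeasure lborel right"
  proof -
    have "emeasure lborel right' = emeasure (distr lborel borel ((+) (- (r *\<^sub>R e)))) right"
      by (subst emeasure_distr) (auto simp: right'_def vimage_def)
    then show ?thesis by (simp add: lborel_distr_plus)
  qed
  have "Z \<inter> D = {}" by (auto simp: Z_def D_def shadowing_def)
  then have "emeasure lborel Z + emeasure lborel D = emeasure lborel (Z \<union> D)"
    by (intro plus_emeasure) simp_all
  also have "\<dots> = emeasure lborel left + emeasure lborel (box0 - edge) + emeasure lborel right'"
  proof -
    have "left \<inter> (box0 - edge) = {}" "(left \<union> (box0 - edge)) \<inter> right' = {}"
      using assms
      by (auto simp: left_def box0_def edge_def right'_def right_def mem_box_cart forall_2 e_nth)
    then show ?thesis unfolding stadium by (simp add: plus_emeasure)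
  qed
  also have "\<dots> = emeasure lborel (box0 - edge) + (emeasure lborel left + emeasure lborel right)"
    by (simp add: right' ac_simps)
  also have "emeasure lborel left + emeasure lborel right = emeasure lborel D"
  proof -
    have "left \<inter> right = {}" "left \<union> right = D" by (auto simp: left_def right_def)
    then show ?thesis by (simp add: plus_emeasure)
  qed
  also have "emeasure lborel (box0 - edge) = emeasure lborel box0 - emeasure lborel edge"
    using assms by (intro emeasure_Diff) (auto simp: edge_def box0_def area_rectangle mem_box_cart forall_2)
  also have "\<dots> = ennreal (2 * r * \<rho>)"
    using assms by (simp add: edge_def box0_def area_rectangle)
  finally have "emeasure lborel D + emeasure lborel Z = emeasure lborel D + ennreal (2 * r * \<rho>)"
    by (simp only: add.commute)
  then have "emeasure lborel Z = ennreal (2 * r * \<rho>)"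
    unfolding ennreal_add_left_cancel by (simp add: D_area)
  then show ?thesis by (simp only: Z_def)
qed

text \<open>The derivative of the sine is at least \<open>cos (pi / 3) = 1 / 2\<close> on the unit
  interval, since pi exceeds 3.\<close>

lemma half_le_sin:
  fixes t :: real
  assumes "0 \<le> t" "t \<le> 1"
  shows "t / 2 \<le> sin t"
proof -
  have "sin 0 - 0 / 2 \<le> sin t - t / 2"
  proof (rule DERIV_nonneg_imp_nondecreasing[OF assms(1)])
    fix x :: real assume x: "0 \<le> x" "x \<le> t"
    then have "cos (pi / 3) \<le> cos x"
      using assms pi_gt3 by (intro cos_monotone_0_pi_le) auto
    then show "\<exists>y. ((\<lambda>t. sin t - t / 2) has_real_derivative y) (at x) \<and> 0 \<le> y"
      by (intro exI[of _ "cos x - 1 / 2"] conjI)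
         (auto intro!: derivative_eq_intros simp: cos_60)
  qed
  then show ?thesis by simp
qed

text \<open>The difference contains a rectangle of width \<open>w\<close> along the far half of the first segment, on
  the side turned away from the second.\<close>
lemma area_shadowing_diff:
  assumes "0 < w" "w \<le> \<rho>" "\<rho> \<le> b" "4 * b \<le> r" "0 \<le> t" "t \<le> 1" "8 * w < t * r"
  shows "ennreal (r / 2 * w)
    \<le> emeasure lborel {x. (x, \<rho>) \<in> shadowing r (dir 0) - shadowing r (dir t)}"
proof -
  define Q where "Q = (cbox (vector [r / 2, - \<rho>]) (vector [r, w - \<rho>]) :: plane set)"
  have "Q \<subseteq> {x. (x, \<rho>) \<in> shadowing r (dir 0) - shadowing r (dir t)}"
  proof
    fix x assume "x \<in> Q"
    then have x: "r / 2 \<le> x $ 1" "x $ 1 \<le> r" "- \<rho> \<le> x $ 2" "x $ 2 \<le> w - \<rho>"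
      by (auto simp: Q_def mem_box_cart forall_2)
    have pos: "0 < b" "0 < r" using assms by linarith+
    have nrm: "\<rho> < norm x"
      using component_le_norm_cart[of x 1] x assms pos by linarith
    have "(x $ 1) *\<^sub>R dir 0 - x = vector [0, - (x $ 2)]" by (simp add: plane_eq_iff)
    then have "norm ((x $ 1) *\<^sub>R dir 0 - x) \<le> \<rho>"
      using x assms by (simp add: norm_plane abs_le_iff)
    then have in0: "(x, \<rho>) \<in> shadowing r (dir 0)"
      using nrm x pos by (auto simp: shadowing_def dist_norm norm_minus_commute intro!: exI[of _ "x $ 1"])
    have cos_nonneg: "0 \<le> cos t" using assms pi_gt3 by (intro cos_ge_zero) auto
    have cos_lower: "1 - t / 2 \<le> cos t"
    proof -
      have "(sin (t / 2))\<^sup>2 \<le> (t / 2)\<^sup>2"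
        using assms abs_sin_x_le_abs_x[of "t / 2"] by (intro abs_le_square_iff[THEN iffD1])
      moreover have "cos t = 1 - 2 * (sin (t / 2))\<^sup>2" using cos_double_sin[of "t / 2"] by simp
      moreover have "t * t \<le> t * 1" using assms by (intro mult_left_mono) auto
      ultimately show ?thesis by (simp add: power2_eq_square)
    qed
    \<comment> \<open>The right side is the signed distance from \<open>x\<close> to the line
      spanned by \<open>dir t\<close>. Its first term is at least \<open>t * r / 4\<close>.
      Replacing \<open>\<rho> * cos t\<close> by \<rho> costs at most \<open>\<rho> * t / 2\<close>,
      which is at most \<open>t * r / 8\<close>, and the width of the rectangle costs at most
      \<open>w\<close>. What remains is positive exactly because
      \<open>8 * w < t * r\<close>.\<close>
    have far: "\<rho> < x $ 1 * sin t - x $ 2 * cos t"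
    proof -
      have "r / 2 * (t / 2) \<le> x $ 1 * sin t"
        using x half_le_sin[of t] assms pos by (intro mult_mono) auto
      moreover have "(\<rho> - w) * cos t \<le> (- (x $ 2)) * cos t"
        using x cos_nonneg by (intro mult_right_mono) auto
      moreover have "\<rho> * (1 - t / 2) \<le> \<rho> * cos t"
        using cos_lower assms by (intro mult_left_mono) auto
      moreover have "w * cos t \<le> w * 1" using assms by (intro mult_left_mono) auto
      moreover have "\<rho> * t \<le> r / 4 * t" using assms by (intro mult_right_mono) auto
      ultimately show ?thesis using assms(7) unfolding left_diff_distrib right_diff_distrib
        by (simp only: mult_minus_left mult_1_right times_divide_eq_left times_divide_eq_right) argo
    qed
    have "(x, \<rho>) \<notin> shadowing r (dir t)"
    proof
      assume "(x, \<rho>) \<in> shadowing r (dir t)"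
      then obtain s where s: "norm (x - s *\<^sub>R dir t) \<le> \<rho>"
        by (auto simp: shadowing_def dist_norm)
      have "x $ 1 * sin t - x $ 2 * cos t = (x - s *\<^sub>R dir t) \<bullet> vector [sin t, - cos t]"
        by (simp add: inner_plane algebra_simps)
      also have "\<dots> \<le> norm (x - s *\<^sub>R dir t) * norm (vector [sin t, - cos t] :: plane)"
        by (rule norm_cauchy_schwarz)
      also have "norm (vector [sin t, - cos t] :: plane) = 1" by (simp add: norm_plane)
      finally show False using far s by simp
    qed
    with in0 show "x \<in> {x. (x, \<rho>) \<in> shadowing r (dir 0) - shadowing r (dir t)}" by simp
  qed
  moreover have "{x. (x, \<rho>) \<in> shadowing r (dir 0) - shadowing r (dir t)} \<in> sets lborel"
  proof -
    have "shadowing r (dir 0) - shadowing r (dir t) \<in> sets (borel \<Otimes>\<^sub>M borel)"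
      using assms by (intro sets.Diff shadowing_measurable) auto
    from sets_Pair2[OF this, of \<rho>] show ?thesis by (simp add: vimage_def)
  qed
  ultimately have "emeasure lborel Q
      \<le> emeasure lborel {x. (x, \<rho>) \<in> shadowing r (dir 0) - shadowing r (dir t)}"
    by (rule emeasure_mono)
  moreover have "emeasure lborel Q = ennreal (r / 2 * w)"
    unfolding Q_def using assms by (subst area_rectangle) auto
  ultimately show ?thesis by simp
qed

section \<open>Void probabilities of the marked process\<close>

context planar_boolean_model
begin

abbreviation PR :: "real measure" where
  "PR \<equiv> distr M borel R"

lemma germ_measurable [measurable]: "random_variable borel (X n)"
  by (rule poisson_germ_measurable[OF germs_poisson])

lemma radius_measurable [measurable]: "random_variable borel (Rad n)"
  using radii_indep by (simp add: indep_vars_def)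

lemma germs_measurable [measurable]:
  "(\<lambda>\<omega> n. X n \<omega>) \<in> M \<rightarrow>\<^sub>M Pi\<^sub>M UNIV (\<lambda>_. borel)"
  by (rule measurable_PiM_single') auto

lemma radii_measurable [measurable]:
  "(\<lambda>\<omega> n. Rad n \<omega>) \<in> M \<rightarrow>\<^sub>M Pi\<^sub>M UNIV (\<lambda>_. borel)"
  by (rule measurable_PiM_single') auto

lemma prob_space_PR: "prob_space PR"
  by (rule prob_space_distr) (rule R_measurable)

sublocale PR: prob_space PR
  by (rule prob_space_PR)

sublocale lborel_PR: pair_sigma_finite "lborel :: plane measure" PR ..

text \<open>Independence of the two sequences in the form that Fubini requires: the germs can be
  frozen while the radii are integrated out.\<close>

lemma distr_germs_radii:
  "distr M (Pi\<^sub>M UNIV (\<lambda>_. borel) \<Otimes>\<^sub>M Pi\<^sub>M UNIV (\<lambda>_. borel)) (\<lambda>\<omega>. (\<lambda>n. X n \<omega>, \<lambda>n. Rad n \<omega>))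
     = distr M (Pi\<^sub>M UNIV (\<lambda>_. borel)) (\<lambda>\<omega> n. X n \<omega>) \<Otimes>\<^sub>M distr M (Pi\<^sub>M UNIV (\<lambda>_. borel)) (\<lambda>\<omega> n. Rad n \<omega>)"
proof (rule pair_measure_eqI[symmetric])
  show "sigma_finite_measure (distr M (Pi\<^sub>M UNIV (\<lambda>_. borel)) (\<lambda>\<omega> n. X n \<omega>))"
    by (intro prob_space_imp_sigma_finite prob_space_distr) measurable
  show "sigma_finite_measure (distr M (Pi\<^sub>M UNIV (\<lambda>_. borel)) (\<lambda>\<omega> n. Rad n \<omega>))"
    by (intro prob_space_imp_sigma_finite prob_space_distr) measurable
  fix A B
  assume AB: "A \<in> sets (distr M (Pi\<^sub>M UNIV (\<lambda>_. borel)) (\<lambda>\<omega> n. X n \<omega>))"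
    "B \<in> sets (distr M (Pi\<^sub>M UNIV (\<lambda>_. borel)) (\<lambda>\<omega> n. Rad n \<omega>))"
  then have [measurable]: "A \<in> sets (Pi\<^sub>M UNIV (\<lambda>_. borel))" "B \<in> sets (Pi\<^sub>M UNIV (\<lambda>_. borel))"
    by simp_all
  have "prob (((\<lambda>\<omega> n. X n \<omega>) -` A \<inter> space M) \<inter> ((\<lambda>\<omega> n. Rad n \<omega>) -` B \<inter> space M))
      = prob ((\<lambda>\<omega> n. X n \<omega>) -` A \<inter> space M) * prob ((\<lambda>\<omega> n. Rad n \<omega>) -` B \<inter> space M)"
    using AB by (intro indep_setD[OF germs_radii_indep]) auto
  moreover have "((\<lambda>\<omega> n. X n \<omega>) -` A \<inter> space M) \<inter> ((\<lambda>\<omega> n. Rad n \<omega>) -` B \<inter> space M)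
      = (\<lambda>\<omega>. (\<lambda>n. X n \<omega>, \<lambda>n. Rad n \<omega>)) -` (A \<times> B) \<inter> space M" by auto
  ultimately show "emeasure (distr M (Pi\<^sub>M UNIV (\<lambda>_. borel)) (\<lambda>\<omega> n. X n \<omega>)) A *
        emeasure (distr M (Pi\<^sub>M UNIV (\<lambda>_. borel)) (\<lambda>\<omega> n. Rad n \<omega>)) B
      = emeasure (distr M (Pi\<^sub>M UNIV (\<lambda>_. borel) \<Otimes>\<^sub>M Pi\<^sub>M UNIV (\<lambda>_. borel))
          (\<lambda>\<omega>. (\<lambda>n. X n \<omega>, \<lambda>n. Rad n \<omega>))) (A \<times> B)"
    by (simp add: emeasure_distr emeasure_eq_measure flip: ennreal_mult)
qed simp

lemma measurable_measure_PR_slice: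
  assumes "B \<in> sets (borel \<Otimes>\<^sub>M borel)"
  shows "(\<lambda>x. measure PR (Pair x -` B)) \<in> borel_measurable borel"
  unfolding measure_def
  using PR.measurable_emeasure_Pair[of B borel] assms
  by (intro borel_measurable_enn2real) (simp cong: sets_pair_measure_cong)

text \<open>Given the germs, the first \<open>N\<close> radii are independent with law
  \<open>PR\<close>, so the conditional probability of avoiding \<open>B\<close> is a product of
  slice probabilities. Infinitely many marks are reached by a limit in \<open>N\<close>.\<close>

lemma prob_avoid_lessThan:
  assumes B [measurable]: "B \<in> sets (borel \<Otimes>\<^sub>M borel)"
  shows "prob {\<omega>\<in>space M. \<forall>n<N. (X n \<omega>, Rad n \<omega>) \<notin> B}
           = expectation (\<lambda>\<omega>. \<Prod>n<N. 1 - measure PR (Pair (X n \<omega>) -` B))"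
proof -
  let ?S = "Pi\<^sub>M (UNIV :: nat set) (\<lambda>_. borel) :: (nat \<Rightarrow> plane) measure"
  let ?T = "Pi\<^sub>M (UNIV :: nat set) (\<lambda>_. borel) :: (nat \<Rightarrow> real) measure"
  let ?DX = "distr M ?S (\<lambda>\<omega> n. X n \<omega>)" and ?DR = "distr M ?T (\<lambda>\<omega> n. Rad n \<omega>)"
  let ?p = "\<lambda>x. \<Prod>n<N. 1 - measure PR (Pair (x n) -` B)"
  define Q where "Q = {z \<in> space (?S \<Otimes>\<^sub>M ?T). \<forall>n<N. (fst z n, snd z n) \<notin> B}"
  have Q [measurable]: "Q \<in> sets (?S \<Otimes>\<^sub>M ?T)" unfolding Q_def by measurable
  interpret DR: prob_space ?DR by (rule prob_space_distr) measurable
  have slice: "emeasure ?DR (Pair x -` Q) = ennreal (?p x)" for x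
  proof -
    have [measurable]: "Pair (x n) -` B \<in> sets borel" for n by (rule sets_Pair1[OF B])
    have "Pair x -` Q \<in> sets ?T" by (rule sets_Pair1[OF Q])
    \<comment> \<open>For \<open>N = 0\<close> the intersection over no index would be
      \<open>UNIV\<close> instead of \<open>space M\<close>.\<close>
    moreover have "(\<lambda>\<omega> n. Rad n \<omega>) -` (Pair x -` Q) \<inter> space M
        = (if N = 0 then space M else (\<Inter>n<N. Rad n -` (- (Pair (x n) -` B)) \<inter> space M))"
      by (auto simp: Q_def space_pair_measure space_PiM)
    ultimately have "emeasure ?DR (Pair x -` Q)
        = prob (if N = 0 then space M else (\<Inter>n<N. Rad n -` (- (Pair (x n) -` B)) \<inter> space M))"
      by (subst emeasure_distr) (auto simp: emeasure_eq_measure)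
    also have "\<dots> = (\<Prod>n<N. prob (Rad n -` (- (Pair (x n) -` B)) \<inter> space M))"
    proof (cases "N = 0")
      case False
      then have "prob (\<Inter>n<N. Rad n -` (- (Pair (x n) -` B)) \<inter> space M)
          = (\<Prod>n<N. prob (Rad n -` (- (Pair (x n) -` B)) \<inter> space M))"
        by (intro indep_varsD[OF radii_indep]) auto
      then show ?thesis using False by simp
    qed (simp add: prob_space)
    also have "\<dots> = ?p x"
    proof (intro arg_cong[where f=ennreal] prod.cong refl)
      fix n
      have "prob (Rad n -` (- (Pair (x n) -` B)) \<inter> space M)
          = measure (distr M borel (Rad n)) (- (Pair (x n) -` B))"
        by (rule measure_distr[symmetric]) auto
      also have "\<dots> = 1 - measure PR (Pair (x n) -` B)"
        unfolding radii_distr using PR.prob_compl[of "Pair (x n) -` B"] by (simp add: Compl_eq_Diff_UNIV)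
      finally show "prob (Rad n -` (- (Pair (x n) -` B)) \<inter> space M)
          = 1 - measure PR (Pair (x n) -` B)" .
    qed
    finally show ?thesis .
  qed
  have p_meas [measurable]: "?p \<in> borel_measurable ?S"
    using measurable_measure_PR_slice[OF B] by measurable
  have p01: "0 \<le> ?p x" for x by (intro prod_nonneg) auto
  have "{\<omega>\<in>space M. \<forall>n<N. (X n \<omega>, Rad n \<omega>) \<notin> B}
      = (\<lambda>\<omega>. (\<lambda>n. X n \<omega>, \<lambda>n. Rad n \<omega>)) -` Q \<inter> space M"
    by (auto simp: Q_def space_pair_measure space_PiM)
  then have "emeasure M {\<omega>\<in>space M. \<forall>n<N. (X n \<omega>, Rad n \<omega>) \<notin> B}
      = emeasure (distr M (?S \<Otimes>\<^sub>M ?T) (\<lambda>\<omega>. (\<lambda>n. X n \<omega>, \<lambda>n. Rad n \<omega>))) Q"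
    by (simp add: emeasure_distr)
  also have "\<dots> = (\<integral>\<^sup>+x. emeasure ?DR (Pair x -` Q) \<partial>?DX)"
    unfolding distr_germs_radii by (rule DR.emeasure_pair_measure_alt) simp
  also have "\<dots> = (\<integral>\<^sup>+\<omega>. ennreal (?p (\<lambda>n. X n \<omega>)) \<partial>M)"
    by (simp add: slice nn_integral_distr)
  also have "\<dots> = ennreal (expectation (\<lambda>\<omega>. ?p (\<lambda>n. X n \<omega>)))"
  proof (rule nn_integral_eq_integral)
    show "integrable M (\<lambda>\<omega>. ?p (\<lambda>n. X n \<omega>))"
    proof (rule integrable_const_bound[where B=1])
      show "random_variable borel (\<lambda>\<omega>. ?p (\<lambda>n. X n \<omega>))"
        using measurable_compose[OF germs_measurable p_meas] .
      show "AE \<omega> in M. norm (?p (\<lambda>n. X n \<omega>)) \<le> 1"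
        by (simp add: abs_prod prod_le_1)
    qed
  qed (use p01 in auto)
  finally show ?thesis
    using p01 by (simp add: emeasure_eq_measure)
qed

text \<open>Only germs in the bounded set \<open>A\<close> can have marks in \<open>B\<close>, so
  almost surely the products \<open>P N\<close> are eventually constant. Dominated convergence
  reduces the claim to the Laplace functional at \<open>g\<close>, the \<open>PR\<close>-mass of the
  slices of \<open>B\<close>, whose integral is the intensity of \<open>B\<close>.\<close>

lemma void_probability_bounded:
  assumes B [measurable]: "B \<in> sets (borel \<Otimes>\<^sub>M borel)"
    and L: "\<And>x \<rho>. (x, \<rho>) \<in> B \<Longrightarrow> norm x \<le> L"
  shows "prob {\<omega>\<in>space M. \<forall>n. (X n \<omega>, Rad n \<omega>) \<notin> B} = exp (- measure (lborel \<Otimes>\<^sub>M PR) B)"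
proof -
  define g where "g x = measure PR (Pair x -` B)" for x
  have g_meas [measurable]: "g \<in> borel_measurable borel"
    unfolding g_def by (rule measurable_measure_PR_slice[OF B])
  have g01: "0 \<le> g x" "g x \<le> 1" for x by (auto simp: g_def)
  define A where "A = cball (0 :: plane) L"
  have A: "A \<in> sets borel" "bounded A" by (auto simp: A_def)
  have g0: "g x = 0" if "x \<notin> A" for x
  proof -
    have "Pair x -` B = {}" using that L by (auto simp: A_def)
    then show ?thesis by (simp add: g_def)
  qed
  define P where "P N \<omega> = (\<Prod>n<N. 1 - g (X n \<omega>))" for N \<omega>
  have P_meas [measurable]: "random_variable borel (P N)" for N unfolding P_def by measurable
  have P01: "0 \<le> P N \<omega>" "P N \<omega> \<le> 1" for N \<omega>
    using g01 by (auto simp: P_def intro!: prod_nonneg prod_le_1)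
  \<comment> \<open>Taking a limit makes \<open>h\<close> measurable at once; its equality with the
    product over the germs in \<open>A\<close> is only needed almost surely.\<close>
  define h where "h \<omega> = lim (\<lambda>N. P N \<omega>)" for \<omega>
  have h_meas [measurable]: "random_variable borel h" unfolding h_def by measurable
  have conv: "(\<lambda>N. P N \<omega>) \<longlonglongrightarrow> (\<Prod>n\<in>{n. X n \<omega> \<in> A}. 1 - g (X n \<omega>))"
    if fin: "finite {n. X n \<omega> \<in> A}" for \<omega>
  proof (rule tendsto_eventually)
    obtain N0 where N0: "{n. X n \<omega> \<in> A} \<subseteq> {..<N0}"
      using finite_nat_bounded[OF fin] by blast
    show "eventually (\<lambda>N. P N \<omega> = (\<Prod>n\<in>{n. X n \<omega> \<in> A}. 1 - g (X n \<omega>))) sequentially"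
    proof (rule eventually_sequentiallyI[of N0])
      fix N assume "N0 \<le> N"
      then show "P N \<omega> = (\<Prod>n\<in>{n. X n \<omega> \<in> A}. 1 - g (X n \<omega>))"
        unfolding P_def using N0 g0 by (intro prod.mono_neutral_right) auto
    qed
  qed
  note lf = poisson_locally_finite[OF germs_poisson A(2)]
  have h_eq: "AE \<omega> in M. h \<omega> = (\<Prod>n\<in>{n. X n \<omega> \<in> A}. 1 - g (X n \<omega>))"
    using lf by eventually_elim (auto simp: h_def dest: conv limI)
  have P_lim: "AE \<omega> in M. (\<lambda>N. P N \<omega>) \<longlonglongrightarrow> h \<omega>"
    using lf h_eq by eventually_elim (simp add: conv)
  have dom: "AE \<omega> in M. norm (P N \<omega>) \<le> 1" for N using P01 by auto
  have h_int: "integrable M h"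
    by (rule integrable_dominated_convergence[where w="\<lambda>_. 1", OF h_meas P_meas _ P_lim dom]) simp
  have "(\<lambda>N. expectation (P N)) \<longlonglongrightarrow> expectation h"
    by (rule integral_dominated_convergence[where w="\<lambda>_. 1", OF h_meas P_meas _ P_lim dom]) simp
  moreover have "(\<lambda>N. expectation (P N)) \<longlonglongrightarrow> prob {\<omega>\<in>space M. \<forall>n. (X n \<omega>, Rad n \<omega>) \<notin> B}"
  proof -
    have "(\<lambda>N. prob {\<omega>\<in>space M. \<forall>n<N. (X n \<omega>, Rad n \<omega>) \<notin> B})
        \<longlonglongrightarrow> prob (\<Inter>N. {\<omega>\<in>space M. \<forall>n<N. (X n \<omega>, Rad n \<omega>) \<notin> B})"
      by (rule finite_Lim_measure_decseq) (auto simp: decseq_def, measurable)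
    moreover have "(\<Inter>N. {\<omega>\<in>space M. \<forall>n<N. (X n \<omega>, Rad n \<omega>) \<notin> B})
        = {\<omega>\<in>space M. \<forall>n. (X n \<omega>, Rad n \<omega>) \<notin> B}" by auto
    ultimately show ?thesis
      unfolding P_def g_def by (simp add: prob_avoid_lessThan[OF B])
  qed
  ultimately have "prob {\<omega>\<in>space M. \<forall>n. (X n \<omega>, Rad n \<omega>) \<notin> B} = expectation h"
    using LIMSEQ_unique by blast
  also have "\<dots> = exp (- (LINT x:A|lborel. g x))"
    by (rule poisson_laplace[OF germs_poisson A g_meas g01 h_int h_eq])
  also have "(LINT x:A|lborel. g x) = (\<integral>x. g x \<partial>lborel)"
    unfolding set_lebesgue_integral_def using g0
    by (intro Bochner_Integration.integral_cong) (auto simp: indicator_def)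
  also have "\<dots> = measure (lborel \<Otimes>\<^sub>M PR) B"
  proof -
    have "emeasure (lborel \<Otimes>\<^sub>M PR) B = (\<integral>\<^sup>+x. ennreal (g x) \<partial>lborel)"
      by (subst PR.emeasure_pair_measure_alt) (auto simp: g_def PR.emeasure_eq_measure)
    then show ?thesis
      unfolding measure_def by (subst integral_eq_nn_integral) (auto simp: g01)
  qed
  finally show ?thesis .
qed

end

section \<open>The intensity of the obstacles\<close>

text \<open>The discs of such a class come within distance \<open>L\<close> of the origin; as the radii are bounded,
  only the germs of a bounded region matter.\<close>
definition local_class :: "(plane \<times> real) set \<Rightarrow> bool" where
  "local_class B \<longleftrightarrow> B \<in> sets (borel \<Otimes>\<^sub>M borel) \<and> (\<exists>L. \<forall>(x, \<rho>)\<in>B. norm x \<le> L + \<rho>)"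

lemma local_class_sets: "local_class B \<Longrightarrow> B \<in> sets (borel \<Otimes>\<^sub>M borel)"
  by (simp add: local_class_def)

lemma local_class_subset:
  "local_class B \<Longrightarrow> C \<subseteq> B \<Longrightarrow> C \<in> sets (borel \<Otimes>\<^sub>M borel) \<Longrightarrow> local_class C"
  unfolding local_class_def by blast

lemma local_class_Un:
  assumes "local_class B" "local_class C"
  shows "local_class (B \<union> C)"
proof -
  obtain L L' where "\<forall>(x, \<rho>)\<in>B. norm x \<le> L + \<rho>" "\<forall>(x, \<rho>)\<in>C. norm x \<le> L' + \<rho>"
    using assms by (auto simp: local_class_def)
  then have "\<forall>(x, \<rho>)\<in>B \<union> C. norm x \<le> max L L' + \<rho>" by fastforce
  then show ?thesis using assms by (auto simp: local_class_def)
qed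

lemma local_class_Int: "local_class B \<Longrightarrow> local_class C \<Longrightarrow> local_class (B \<inter> C)"
  by (rule local_class_subset[of B]) (auto simp: local_class_def)

lemma local_class_Diff: "local_class B \<Longrightarrow> local_class C \<Longrightarrow> local_class (B - C)"
  by (rule local_class_subset[of B]) (auto simp: local_class_def)

definition origin_covering :: "(plane \<times> real) set" where
  "origin_covering = {(x, \<rho>). norm x \<le> \<rho>}"

lemma local_class_origin_covering: "local_class origin_covering"
proof -
  have "origin_covering = {z \<in> space (borel \<Otimes>\<^sub>M borel). norm (fst z) \<le> snd z}"
    by (auto simp: origin_covering_def space_pair_measure)
  also have "\<dots> \<in> sets (borel \<Otimes>\<^sub>M borel)" by measurable
  finally show ?thesis
    unfolding local_class_def by (intro conjI exI[of _ 0]) (auto simp: origin_covering_def)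
qed

lemma local_class_shadowing: "0 \<le> r \<Longrightarrow> local_class (shadowing r (dir \<theta>))"
  unfolding local_class_def
  by (intro conjI exI[of _ r]) (auto dest: shadowing_norm_le)

lemma origin_covering_Int_shadowing: "origin_covering \<inter> shadowing r u = {}"
  by (auto simp: origin_covering_def shadowing_def)

text \<open>The marks of all obstacles that reach the disc of radius \<open>r\<close> about the
  origin without covering the origin. Normalising the intensity on this set gives
  \<open>obstacle_law\<close>.\<close>

definition annulus :: "real \<Rightarrow> (plane \<times> real) set" where
  "annulus r = {(x, \<rho>). \<rho> < norm x \<and> norm x \<le> \<rho> + r}"

lemma local_class_annulus: "local_class (annulus r)"
proof -
  have "annulus r = {z \<in> space (borel \<Otimes>\<^sub>M borel). snd z < norm (fst z) \<and> norm (fst z) \<le> snd z + r}"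
    by (auto simp: annulus_def space_pair_measure)
  also have "\<dots> \<in> sets (borel \<Otimes>\<^sub>M borel)" by measurable
  finally show ?thesis
    unfolding local_class_def by (intro conjI exI[of _ r]) (auto simp: annulus_def)
qed

lemma shadowing_subset_annulus: "norm u = 1 \<Longrightarrow> shadowing r u \<subseteq> annulus r"
  using shadowing_norm_le by (fastforce simp: annulus_def shadowing_def)

context planar_boolean_model
begin

abbreviation intensity :: "(plane \<times> real) measure" where
  "intensity \<equiv> lborel \<Otimes>\<^sub>M PR"

lemma sets_intensity: "sets intensity = sets (borel \<Otimes>\<^sub>M borel)"
  by (intro sets_pair_measure_cong) auto

lemma PR_pos: "AE \<rho> in PR. 0 < \<rho>"
  using R_positive R_measurable by (subst AE_distr_iff) auto

lemma PR_bounded: obtains b where "0 < b" "AE \<rho> in PR. \<rho> \<le> b"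
proof -
  obtain b where "AE \<omega> in M. R \<omega> \<le> b" using R_bounded by blast
  then have "AE \<rho> in PR. \<rho> \<le> max b 1"
    using R_measurable by (subst AE_distr_iff) (auto elim: eventually_mono)
  then show thesis using that[of "max b 1"] by simp
qed

lemma radii_bounded:
  assumes "AE \<rho> in PR. \<rho> \<le> b"
  shows "AE \<omega> in M. \<forall>n. Rad n \<omega> \<le> b"
proof (subst AE_all_countable, rule allI)
  fix n
  have "AE \<rho> in distr M borel (Rad n). \<rho> \<le> b" unfolding radii_distr by (rule assms)
  then show "AE \<omega> in M. Rad n \<omega> \<le> b" by (subst (asm) AE_distr_iff) auto
qed

lemma R_integrable: "integrable M R"
proof -
  obtain b where "AE \<omega> in M. R \<omega> \<le> b" using R_bounded by blast
  then have "AE \<omega> in M. norm (R \<omega>) \<le> b"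
    using R_positive by eventually_elim simp
  then show ?thesis using R_measurable by (rule integrable_const_bound)
qed

lemma expectation_R_pos: "0 < expectation R"
proof -
  have "0 \<le> expectation R"
    using R_positive by (intro integral_nonneg_AE) (auto elim: eventually_mono)
  moreover have "expectation R \<noteq> 0"
  proof
    assume "expectation R = 0"
    then have "AE \<omega> in M. R \<omega> = 0"
      using R_positive R_integrable
      by (subst (asm) integral_nonneg_eq_0_iff_AE) (auto elim: eventually_mono)
    with R_positive have "AE \<omega> in M. False" by eventually_elim simp
    then show False by simp
  qed
  ultimately show ?thesis by simp
qed

lemma nn_integral_PR_affine:
  assumes "0 \<le> c" "0 \<le> d"
  shows "(\<integral>\<^sup>+\<rho>. ennreal (c * \<rho> + d) \<partial>PR) = ennreal (c * expectation R + d)"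
proof -
  have "(\<integral>\<^sup>+\<rho>. ennreal (c * \<rho> + d) \<partial>PR) = (\<integral>\<^sup>+\<omega>. ennreal (c * R \<omega> + d) \<partial>M)"
    using R_measurable by (subst nn_integral_distr) auto
  also have "\<dots> = ennreal (expectation (\<lambda>\<omega>. c * R \<omega> + d))"
    using R_positive R_integrable assms
    by (intro nn_integral_eq_integral) (auto elim: eventually_mono)
  also have "expectation (\<lambda>\<omega>. c * R \<omega> + d) = c * expectation R + d"
    using R_integrable by (simp add: prob_space)
  finally show ?thesis .
qed

lemma emeasure_intensity:
  assumes "B \<in> sets (borel \<Otimes>\<^sub>M borel)"
  shows "emeasure intensity B = (\<integral>\<^sup>+\<rho>. emeasure lborel {x. (x, \<rho>) \<in> B} \<partial>PR)"
  using assms by (subst lborel_PR.emeasure_pair_measure_alt2) (auto simp: sets_intensity vimage_def)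

lemma local_class_truncate_norm_le:
  assumes "local_class B"
  obtains L where "\<forall>(x, \<rho>)\<in>B \<inter> (UNIV \<times> {..b}). norm x \<le> L"
proof -
  obtain L where "\<forall>(x, \<rho>)\<in>B. norm x \<le> L + \<rho>" using assms by (auto simp: local_class_def)
  then have "\<forall>(x, \<rho>)\<in>B \<inter> (UNIV \<times> {..b}). norm x \<le> L + b" by fastforce
  then show thesis by (rule that)
qed

lemma emeasure_intensity_truncate:
  assumes "local_class B" "AE \<rho> in PR. \<rho> \<le> b"
  shows "emeasure intensity (B \<inter> (UNIV \<times> {..b})) = emeasure intensity B"
  using assms local_class_sets[OF assms(1)]
  by (subst (1 2) emeasure_intensity) (auto intro!: nn_integral_cong_AE elim!: eventually_mono)

lemma emeasure_intensity_finite: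
  assumes "local_class B"
  shows "emeasure intensity B < \<infinity>"
proof -
  obtain b where b: "AE \<rho> in PR. \<rho> \<le> b" by (rule PR_bounded)
  obtain L where L: "\<forall>(x, \<rho>)\<in>B \<inter> (UNIV \<times> {..b}). norm x \<le> L"
    by (rule local_class_truncate_norm_le[OF assms])
  have "B \<inter> (UNIV \<times> {..b}) \<subseteq> cball 0 L \<times> UNIV" using L by fastforce
  then have "emeasure intensity B \<le> emeasure intensity (cball 0 L \<times> UNIV)"
    unfolding emeasure_intensity_truncate[OF assms b, symmetric] by (rule emeasure_mono) simp
  also have "\<dots> = emeasure lborel (cball 0 L :: plane set) * emeasure PR UNIV"
    by (rule PR.emeasure_pair_measure_Times) auto
  also have "\<dots> < \<infinity>"
    using PR.emeasure_space_1 emeasure_bounded_finite[OF bounded_cball, of 0 L] by simp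
  finally show ?thesis .
qed

definition void :: "(plane \<times> real) set \<Rightarrow> 'w set" where
  "void B = {\<omega>\<in>space M. \<forall>n. (X n \<omega>, Rad n \<omega>) \<notin> B}"

lemma void_measurable [measurable]:
  assumes [measurable]: "B \<in> sets (borel \<Otimes>\<^sub>M borel)"
  shows "void B \<in> sets M"
  unfolding void_def by measurable

text \<open>Almost surely no radius exceeds \<open>b\<close>. Cutting \<open>B\<close> at this
  height changes neither its intensity nor, up to a null set, the event, and leaves only germs in a
  bounded region.\<close>

lemma prob_void:
  assumes "local_class B"
  shows "prob (void B) = exp (- measure intensity B)"
proof -
  obtain b where b: "AE \<rho> in PR. \<rho> \<le> b" by (rule PR_bounded)
  obtain L where L: "\<forall>(x, \<rho>)\<in>B \<inter> (UNIV \<times> {..b}). norm x \<le> L"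
    by (rule local_class_truncate_norm_le[OF assms])
  have [measurable]: "B \<in> sets (borel \<Otimes>\<^sub>M borel)" by (rule local_class_sets[OF assms])
  have "prob (void B) = prob (void (B \<inter> (UNIV \<times> {..b})))"
  proof (rule measure_eq_AE)
    show "AE \<omega> in M. \<omega> \<in> void B \<longleftrightarrow> \<omega> \<in> void (B \<inter> (UNIV \<times> {..b}))"
      using radii_bounded[OF b] by eventually_elim (auto simp: void_def)
  qed auto
  also have "\<dots> = exp (- measure intensity (B \<inter> (UNIV \<times> {..b})))"
    unfolding void_def using L by (intro void_probability_bounded[of _ L]) auto
  finally show ?thesis by (simp add: measure_def emeasure_intensity_truncate[OF assms b])
qed

lemma measure_intensity_Un:
  assumes "local_class B" "local_class C" "B \<inter> C = {}"
  shows "measure intensity (B \<union> C) = measure intensity B + measure intensity C"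
  using assms emeasure_intensity_finite[of B] emeasure_intensity_finite[of C]
  by (intro measure_Union) (auto simp: sets_intensity local_class_sets)

lemma measure_intensity_mono:
  assumes "local_class B" "local_class C" "B \<subseteq> C"
  shows "measure intensity B \<le> measure intensity C"
  using assms emeasure_intensity_finite[of C]
  by (intro measure_mono_fmeasurable) (auto simp: fmeasurable_def sets_intensity local_class_sets)

lemma emeasure_intensity_eq_measure:
  "local_class B \<Longrightarrow> emeasure intensity B = ennreal (measure intensity B)"
  using emeasure_intensity_finite[of B] by (intro emeasure_eq_ennreal_measure) auto

section \<open>Intensities of a shadow class and of all obstacles\<close>

lemma measure_intensity_rot:
  assumes "B \<in> sets (borel \<Otimes>\<^sub>M borel)" "C \<in> sets (borel \<Otimes>\<^sub>M borel)"
    and "\<And>x \<rho>. (rot \<theta> x, \<rho>) \<in> C \<longleftrightarrow> (x, \<rho>) \<in> B"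
  shows "measure intensity C = measure intensity B"
proof -
  have "emeasure lborel {x. (x, \<rho>) \<in> C} = emeasure lborel {x. (x, \<rho>) \<in> B}" for \<rho>
  proof -
    have "{x. (x, \<rho>) \<in> C} \<in> sets borel"
      using sets_Pair2[OF assms(2), of \<rho>] by (simp add: vimage_def)
    from emeasure_lborel_rot_vimage[OF this, of \<theta>] show ?thesis
      by (simp add: assms(3) vimage_def)
  qed
  then show ?thesis using assms by (simp add: measure_def emeasure_intensity)
qed

lemma measure_shadowing:
  assumes "0 \<le> r"
  shows "measure intensity (shadowing r (dir \<theta>)) = 2 * r * expectation R"
proof -
  have "measure intensity (shadowing r (dir \<theta>)) = measure intensity (shadowing r (dir 0))"
    using assms shadowing_rot[of \<theta> _ _ r 0] by (intro measure_intensity_rot[of _ _ \<theta>]) auto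
  moreover have "emeasure intensity (shadowing r (dir 0)) = ennreal (2 * r * expectation R)"
  proof -
    have "emeasure intensity (shadowing r (dir 0)) = (\<integral>\<^sup>+\<rho>. ennreal (2 * r * \<rho> + 0) \<partial>PR)"
      using assms PR_pos by (subst emeasure_intensity)
        (auto intro!: nn_integral_cong_AE elim!: eventually_mono simp: area_shadowing)
    also have "\<dots> = ennreal (2 * r * expectation R + 0)"
      using assms by (intro nn_integral_PR_affine) auto
    finally show ?thesis by simp
  qed
  ultimately show ?thesis
    using assms expectation_R_pos by (simp add: measure_def)
qed

lemma emeasure_annulus:
  assumes "0 \<le> r"
  shows "emeasure intensity (annulus r) = ennreal (pi * (2 * r * expectation R + r\<^sup>2))"
proof -
  have "emeasure intensity (annulus r) = (\<integral>\<^sup>+\<rho>. ennreal (2 * pi * r * \<rho> + pi * r\<^sup>2) \<partial>PR)"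
    using assms PR_pos
    by (subst emeasure_intensity[OF local_class_sets[OF local_class_annulus]])
      (auto intro!: nn_integral_cong_AE elim!: eventually_mono
        simp: annulus_def area_annulus algebra_simps)
  also have "\<dots> = ennreal (2 * pi * r * expectation R + pi * r\<^sup>2)"
    using assms by (intro nn_integral_PR_affine) auto
  finally show ?thesis by (simp add: algebra_simps)
qed

lemma measure_annulus:
  "0 \<le> r \<Longrightarrow> measure intensity (annulus r) = pi * (2 * r * expectation R + r\<^sup>2)"
  using emeasure_annulus[of r] expectation_R_pos by (simp add: measure_def)

end

section \<open>The mean shadow\<close>

lemma sets_shadowing_dir_joint:
  assumes "0 \<le> r"
  shows "{(\<theta>, z). z \<in> shadowing r (dir \<theta>)} \<in> sets (borel \<Otimes>\<^sub>M (borel \<Otimes>\<^sub>M borel))"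
proof -
  have "{(\<theta>, z). z \<in> shadowing r (dir \<theta>)}
      = {y \<in> space (borel \<Otimes>\<^sub>M (borel \<Otimes>\<^sub>M borel)). snd (snd y) < norm (fst (snd y)) \<and>
          norm (max 0 (min r (dir (fst y) \<bullet> fst (snd y))) *\<^sub>R dir (fst y) - fst (snd y)) \<le> snd (snd y)}"
    using shadowing_iff_clamp[OF norm_dir assms] by (auto simp: space_pair_measure)
  then show ?thesis by simp
qed

definition arc_angles :: "real \<Rightarrow> plane \<times> real \<Rightarrow> real set" where
  "arc_angles r z = {\<theta> \<in> {0..<2 * pi}. dir \<theta> \<in> shadow r (fst z) (snd z)}"

lemma normalised_arc_length_shadow:
  "normalised_arc_length (shadow r x \<rho>) = measure lborel (arc_angles r (x, \<rho>)) / (2 * pi)"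
  by (simp add: normalised_arc_length_def arc_angles_def dir_def)

lemma sets_arc_angles_joint:
  assumes "0 \<le> r"
  shows "{(z, \<theta>). \<theta> \<in> arc_angles r z} \<in> sets ((borel \<Otimes>\<^sub>M borel) \<Otimes>\<^sub>M borel)"
proof -
  have "{(z, \<theta>). \<theta> \<in> arc_angles r z}
      = {y \<in> space ((borel \<Otimes>\<^sub>M borel) \<Otimes>\<^sub>M borel). 0 \<le> snd y \<and> snd y < 2 * pi \<and>
          norm (max 0 (min r (dir (snd y) \<bullet> fst (fst y))) *\<^sub>R dir (snd y) - fst (fst y)) \<le> snd (fst y)}"
    using segment_meets_cball_iff[OF norm_dir assms]
    by (auto simp: space_pair_measure arc_angles_def shadow_def)
  then show ?thesis by simp
qed

lemma arc_angles_annulus: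
  assumes "z \<in> annulus r"
  shows "arc_angles r z = {\<theta> \<in> {0..<2 * pi}. z \<in> shadowing r (dir \<theta>)}"
  using assms by (auto simp: arc_angles_def shadow_def shadowing_def annulus_def)

context planar_boolean_model
begin

text \<open>After exchanging the integrals, the inner one is the intensity of the marks shadowing a
  given angle. By rotation invariance it is the same for all angles, and the length of the circle
  cancels \<open>2 * pi\<close>.\<close>

lemma nn_integral_arc_angles:
  assumes "0 \<le> r"
  shows "(\<integral>\<^sup>+z. ennreal (measure lborel (arc_angles r z) / (2 * pi)) * indicator (annulus r) z \<partial>intensity)
    = ennreal (2 * r * expectation R)"
proof -
  have [measurable]: "{(\<theta>, z). z \<in> shadowing r (dir \<theta>)} \<in> sets (borel \<Otimes>\<^sub>M intensity)"
    using sets_shadowing_dir_joint[OF assms] by (simp cong: sets_pair_measure_cong)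
  let ?f = "\<lambda>\<theta> z. ennreal (1 / (2 * pi)) * indicator {0..<2 * pi} \<theta>
    * indicator {(\<theta>, z). z \<in> shadowing r (dir \<theta>)} (\<theta> :: real, z)"
  have "ennreal (measure lborel (arc_angles r z) / (2 * pi)) * indicator (annulus r) z
      = (\<integral>\<^sup>+\<theta>. ?f \<theta> z \<partial>lborel)" for z
  proof (cases "z \<in> annulus r")
    case True
    have "bounded (arc_angles r z)"
      by (rule bounded_subset[of "{0..2 * pi}"]) (auto simp: arc_angles_def)
    then have fin: "emeasure lborel (arc_angles r z) \<noteq> top"
      using emeasure_bounded_finite[of "arc_angles r z"] by simp
    have "arc_angles r z \<in> sets lborel"
      using sets_Pair1[OF sets_arc_angles_joint[OF assms], of z] by (simp add: vimage_def)
    then have "(\<integral>\<^sup>+\<theta>. ?f \<theta> z \<partial>lborel) = ennreal (1 / (2 * pi)) * emeasure lborel (arc_angles r z)"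
      by (subst nn_integral_cmult_indicator[symmetric])
        (auto intro!: nn_integral_cong simp: indicator_def arc_angles_annulus[OF True])
    also have "\<dots> = ennreal (measure lborel (arc_angles r z) / (2 * pi))"
      by (simp add: emeasure_eq_ennreal_measure[OF fin] flip: ennreal_mult)
    finally show ?thesis using True by simp
  next
    case False
    then have "z \<notin> shadowing r (dir \<theta>)" for \<theta> using shadowing_subset_annulus[OF norm_dir] by blast
    then show ?thesis using False by simp
  qed
  then have "(\<integral>\<^sup>+z. ennreal (measure lborel (arc_angles r z) / (2 * pi)) * indicator (annulus r) z \<partial>intensity)
      = (\<integral>\<^sup>+z. \<integral>\<^sup>+\<theta>. ?f \<theta> z \<partial>lborel \<partial>intensity)" by simp
  also have "\<dots> = (\<integral>\<^sup>+\<theta>. \<integral>\<^sup>+z. ?f \<theta> z \<partial>intensity \<partial>lborel)"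
  proof (rule pair_sigma_finite.Fubini')
    show "pair_sigma_finite lborel intensity"
      by (intro pair_sigma_finite.intro sigma_finite_lborel lborel_PR.P.sigma_finite_measure_axioms)
  qed measurable
  also have "\<dots> = (\<integral>\<^sup>+\<theta>. ennreal (2 * r * expectation R / (2 * pi)) * indicator {0..<2 * pi} (\<theta> :: real) \<partial>lborel)"
  proof (rule nn_integral_cong)
    fix \<theta> :: real
    have "shadowing r (dir \<theta>) \<in> sets intensity"
      using assms by (simp add: sets_intensity)
    then have "(\<integral>\<^sup>+z. ?f \<theta> z \<partial>intensity)
        = ennreal (1 / (2 * pi)) * indicator {0..<2 * pi} \<theta> * emeasure intensity (shadowing r (dir \<theta>))"
      by (subst nn_integral_cmult_indicator[symmetric]) (auto intro!: nn_integral_cong simp: indicator_def)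
    also have "\<dots> = ennreal (1 / (2 * pi)) * ennreal (2 * r * expectation R) * indicator {0..<2 * pi} \<theta>"
      using assms by (simp add: emeasure_intensity_eq_measure local_class_shadowing measure_shadowing mult_ac)
    also have "ennreal (1 / (2 * pi)) * ennreal (2 * r * expectation R) = ennreal (2 * r * expectation R / (2 * pi))"
      using assms expectation_R_pos by (simp flip: ennreal_mult)
    finally show "(\<integral>\<^sup>+z. ?f \<theta> z \<partial>intensity)
        = ennreal (2 * r * expectation R / (2 * pi)) * indicator {0..<2 * pi} \<theta>" .
  qed
  also have "\<dots> = ennreal (2 * r * expectation R / (2 * pi)) * ennreal (2 * pi)"
    by (subst nn_integral_cmult_indicator) auto
  also have "\<dots> = ennreal (2 * r * expectation R)"
    using assms expectation_R_pos by (simp flip: ennreal_mult)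
  finally show ?thesis .
qed

lemma mean_shadow_eq:
  assumes "0 < r"
  shows "mean_shadow PR r = 2 * r * expectation R / (pi * (2 * r * expectation R + r\<^sup>2))"
proof -
  let ?A = "annulus r"
  let ?g = "\<lambda>z. measure lborel (arc_angles r z) / (2 * pi)"
  have law: "obstacle_law PR r = uniform_measure intensity ?A"
    by (simp add: obstacle_law_def annulus_def)
  have A: "?A \<in> sets intensity"
    using local_class_sets[OF local_class_annulus] by (simp add: sets_intensity)
  have pos: "0 < pi * (2 * r * expectation R + r\<^sup>2)"
    using assms expectation_R_pos by (intro mult_pos_pos add_pos_pos) auto
  have g_borel: "?g \<in> borel_measurable (borel \<Otimes>\<^sub>M borel)"
  proof -
    have "(\<lambda>z. emeasure lborel (Pair z -` {(z, \<theta>). \<theta> \<in> arc_angles r z})) \<in> borel_measurable (borel \<Otimes>\<^sub>M borel)"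
      using sets_arc_angles_joint[of r] assms
      by (intro lborel.measurable_emeasure_Pair) (simp cong: sets_pair_measure_cong)
    then show ?thesis unfolding measure_def by (simp add: vimage_def)
  qed
  have g_meas: "?g \<in> borel_measurable intensity"
    using g_borel by (simp cong: measurable_cong_sets add: sets_intensity)
  have "mean_shadow PR r = (\<integral>z. ?g z \<partial>obstacle_law PR r)"
    unfolding mean_shadow_def shadow_law_def
    using g_meas by (subst integral_distr) (auto simp: law normalised_arc_length_shadow split_def)
  also have "\<dots> = enn2real (\<integral>\<^sup>+z. ennreal (?g z) \<partial>uniform_measure intensity ?A)"
    unfolding law using g_meas by (intro integral_eq_nn_integral) auto
  also have "(\<integral>\<^sup>+z. ennreal (?g z) \<partial>uniform_measure intensity ?A)
      = (\<integral>\<^sup>+z. ennreal (?g z) * indicator ?A z \<partial>intensity) / emeasure intensity ?A"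
    using A g_meas by (intro nn_integral_uniform_measure) auto
  also have "\<dots> = ennreal (2 * r * expectation R) / ennreal (pi * (2 * r * expectation R + r\<^sup>2))"
    using assms by (simp only: nn_integral_arc_angles emeasure_annulus less_imp_le)
  also have "\<dots> = ennreal (2 * r * expectation R / (pi * (2 * r * expectation R + r\<^sup>2)))"
    using assms expectation_R_pos pos by (intro divide_ennreal) auto
  finally show ?thesis
    using assms expectation_R_pos pos by simp
qed

lemma mean_shadow_asymp:
  "mean_shadow PR \<sim>[at_top] (\<lambda>r. 2 * expectation R / (pi * r))"
proof (rule asymp_equivI')
  let ?E = "expectation R"
  have "eventually (\<lambda>r. inverse (1 + 2 * ?E * inverse r) = mean_shadow PR r / (2 * ?E / (pi * r))) at_top"
    using eventually_gt_at_top[of 0]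
  proof eventually_elim
    case (elim r)
    define c where "c = 1 + 2 * ?E * inverse r"
    have c: "2 * r * ?E + r\<^sup>2 = r\<^sup>2 * c" "0 < c"
      using elim expectation_R_pos by (auto simp: c_def field_simps power2_eq_square intro!: add_pos_pos)
    then show ?case
      using elim expectation_R_pos unfolding mean_shadow_eq[OF elim] c_def[symmetric] c(1)
      by (simp add: field_simps power2_eq_square)
  qed
  moreover have "((\<lambda>r. inverse (1 + 2 * ?E * inverse r)) \<longlongrightarrow> inverse (1 + 2 * ?E * 0)) at_top"
    by (intro tendsto_intros tendsto_inverse_0_at_top filterlim_ident) auto
  ultimately show "((\<lambda>r. mean_shadow PR r / (2 * ?E / (pi * r))) \<longlongrightarrow> 1) at_top"
    using Lim_transform_eventually by fastforce
qed

end

section \<open>Clear directions\<close>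

text \<open>Induction on \<open>n\<close>: the overlap of the new event with the earlier union is at
  most the sum of its pairwise intersections.\<close>

lemma (in prob_space) prob_UN_ge_Bonferroni:
  fixes n :: nat
  assumes "\<And>i. i < n \<Longrightarrow> F i \<in> events"
  shows "(\<Sum>i<n. prob (F i)) - (\<Sum>i<n. \<Sum>j<i. prob (F j \<inter> F i)) \<le> prob (\<Union>i<n. F i)"
  using assms
proof (induction n)
  case (Suc n)
  have [measurable]: "F i \<in> events" if "i \<le> n" for i using Suc.prems that by simp
  have U: "(\<Union>i<n. F i) \<in> events" using Suc.prems by (intro sets.finite_UN) auto
  have "prob ((\<Union>j<n. F j) \<inter> F n) = prob (\<Union>j<n. F j \<inter> F n)" by simp
  also have "\<dots> \<le> (\<Sum>j<n. prob (F j \<inter> F n))"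
    by (rule finite_measure_subadditive_finite) auto
  finally have "prob ((\<Union>j<n. F j) \<inter> F n) \<le> (\<Sum>j<n. prob (F j \<inter> F n))" .
  moreover have "prob ((\<Union>j<n. F j) \<union> F n)
      = prob (\<Union>j<n. F j) + prob (F n) - prob ((\<Union>j<n. F j) \<inter> F n)"
    using U by (intro measure_Un3) (auto simp: fmeasurable_eq_sets)
  moreover have "(\<Union>i<Suc n. F i) = (\<Union>j<n. F j) \<union> F n" by (auto simp: lessThan_Suc)
  ultimately show ?case using Suc by simp
qed simp

text \<open>Each event adds at most its part outside its immediate predecessor. For strongly
  correlated neighbours, such as consecutive arcs, this is far smaller than the union bound.\<close>

lemma (in prob_space) prob_UN_le_chain:
  fixes n :: nat
  assumes "\<And>i. i \<le> n \<Longrightarrow> F i \<in> events"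
  shows "prob (\<Union>i\<le>n. F i) \<le> prob (F 0) + (\<Sum>i<n. prob (F (Suc i)) - prob (F (Suc i) \<inter> F i))"
  using assms
proof (induction n)
  case (Suc n)
  have [measurable]: "F i \<in> events" if "i \<le> Suc n" for i using Suc.prems that by simp
  have U: "(\<Union>i\<le>n. F i) \<in> events" using Suc.prems by (intro sets.finite_UN) auto
  have "prob (\<Union>i\<le>Suc n. F i) \<le> prob ((\<Union>i\<le>n. F i) \<union> (F (Suc n) - F n))"
    using U by (intro finite_measure_mono) (auto simp: le_Suc_eq)
  also have "\<dots> \<le> prob (\<Union>i\<le>n. F i) + prob (F (Suc n) - F n)"
    using U by (intro measure_Un_le) auto
  also have "prob (F (Suc n) - F n) = prob (F (Suc n)) - prob (F (Suc n) \<inter> F n)"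
    using finite_measure_Diff'[of "F (Suc n)" "F n"] by simp
  finally show ?case using Suc by simp
qed simp

context planar_boolean_model
begin

text \<open>The marks covering the origin are excluded too, so this event lies inside the
  conditioning event.\<close>

definition clear :: "real \<Rightarrow> real \<Rightarrow> 'w set" where
  "clear r \<theta> = void (origin_covering \<union> shadowing r (dir \<theta>))"

lemma clear_iff:
  assumes "0 \<le> r"
  shows "\<omega> \<in> clear r \<theta> \<longleftrightarrow> \<omega> \<in> space M \<and>
    (\<forall>s. 0 \<le> s \<longrightarrow> s \<le> r \<longrightarrow> s *\<^sub>R dir \<theta> \<notin> occupied_phase X Rad \<omega>)"
proof -
  have "(x, \<rho>) \<in> origin_covering \<union> shadowing r (dir \<theta>)
      \<longleftrightarrow> (\<exists>s. 0 \<le> s \<and> s \<le> r \<and> s *\<^sub>R dir \<theta> \<in> cball x \<rho>)" for x \<rho>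
    using assms by (auto simp: origin_covering_def shadowing_def not_le intro: exI[of _ 0])
  then show ?thesis
    unfolding clear_def void_def occupied_phase_def by blast
qed

lemma local_class_clear: "0 \<le> r \<Longrightarrow> local_class (origin_covering \<union> shadowing r (dir \<theta>))"
  by (intro local_class_Un local_class_origin_covering local_class_shadowing)

lemma clear_measurable: "0 \<le> r \<Longrightarrow> clear r \<theta> \<in> sets M"
  unfolding clear_def by (intro void_measurable local_class_sets local_class_clear)

text \<open>Intensities of disjoint classes add in the exponent. The first factor is the probability
  of the conditioning event and cancels in \<open>visibility_prob\<close>.\<close>

lemma prob_void_origin_Un:
  assumes "local_class B" "origin_covering \<inter> B = {}"
  shows "prob (void (origin_covering \<union> B)) = prob (void origin_covering) * exp (- measure intensity B)"
  using assms local_class_origin_covering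
  by (simp add: prob_void local_class_Un measure_intensity_Un exp_diff exp_minus divide_inverse)

section \<open>Joint intensities of two directions\<close>

lemma measure_intensity_Diff_shadowing_rot:
  assumes "0 \<le> r"
  shows "measure intensity (shadowing r (dir (\<theta> + \<alpha>)) - shadowing r (dir (\<theta> + \<beta>)))
    = measure intensity (shadowing r (dir \<alpha>) - shadowing r (dir \<beta>))"
  using assms by (intro measure_intensity_rot[of _ _ \<theta>])
    (auto simp: shadowing_rot intro!: sets.Diff)

lemma measure_shadowing_Un:
  assumes "0 \<le> r"
  shows "measure intensity (shadowing r (dir \<alpha>) \<union> shadowing r (dir \<beta>))
    = 2 * r * expectation R + measure intensity (shadowing r (dir \<alpha>) - shadowing r (dir \<beta>))"
proof -
  have "shadowing r (dir \<alpha>) \<union> shadowing r (dir \<beta>)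
      = shadowing r (dir \<beta>) \<union> (shadowing r (dir \<alpha>) - shadowing r (dir \<beta>))" by auto
  then show ?thesis
    using assms measure_intensity_Un[of "shadowing r (dir \<beta>)" "shadowing r (dir \<alpha>) - shadowing r (dir \<beta>)"]
    by (simp add: local_class_shadowing local_class_Diff measure_shadowing)
qed

lemma measure_shadowing_Int:
  assumes "0 \<le> r"
  shows "measure intensity (shadowing r (dir \<alpha>) \<inter> shadowing r (dir \<beta>))
    = 2 * r * expectation R - measure intensity (shadowing r (dir \<alpha>) - shadowing r (dir \<beta>))"
proof -
  have "measure intensity (shadowing r (dir \<alpha>))
      = measure intensity (shadowing r (dir \<alpha>) \<inter> shadowing r (dir \<beta>))
        + measure intensity (shadowing r (dir \<alpha>) - shadowing r (dir \<beta>))"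
    using assms
    by (subst measure_intensity_Un[symmetric])
       (auto simp: local_class_shadowing local_class_Diff local_class_Int intro!: arg_cong[where f="measure intensity"])
  then show ?thesis using assms by (simp add: measure_shadowing)
qed

lemma prob_clear:
  assumes "0 \<le> r"
  shows "prob (clear r \<theta>) = prob (void origin_covering) * exp (- (2 * r * expectation R))"
  unfolding clear_def using assms
  by (simp add: prob_void_origin_Un local_class_shadowing origin_covering_Int_shadowing measure_shadowing)

text \<open>At least half of the radii are at least \<open>w\<close>, and each of these contributes
  the area \<open>r / 2 * w\<close> of the rectangle in \<open>area_shadowing_diff\<close>.\<close>

lemma measure_shadowing_Diff_ge:
  assumes w: "0 < w" "1 / 2 \<le> measure PR {w..}" and b: "AE \<rho> in PR. \<rho> \<le> b"
    and r: "4 * b \<le> r" and t: "0 \<le> t" "t \<le> 1" "8 * w < t * r"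
  shows "r * w / 4 \<le> measure intensity (shadowing r (dir 0) - shadowing r (dir t))"
proof -
  have "0 < r" using w t mult_nonneg_nonpos[of t r] by (smt (verit))
  define D where "D = shadowing r (dir 0) - shadowing r (dir t)"
  have D: "local_class D"
    unfolding D_def using \<open>0 < r\<close> by (intro local_class_Diff local_class_shadowing) auto
  have "ennreal (r * w / 4) \<le> ennreal (r / 2 * w * measure PR {w..})"
  proof (rule ennreal_leI)
    have "r / 2 * w * (1 / 2) \<le> r / 2 * w * measure PR {w..}"
      using w \<open>0 < r\<close> by (intro mult_left_mono) auto
    then show "r * w / 4 \<le> r / 2 * w * measure PR {w..}" by simp
  qed
  also have "\<dots> = ennreal (r / 2 * w) * emeasure PR {w..}"
    using w \<open>0 < r\<close> by (simp add: PR.emeasure_eq_measure flip: ennreal_mult)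
  also have "\<dots> = (\<integral>\<^sup>+\<rho>. ennreal (r / 2 * w) * indicator {w..} \<rho> \<partial>PR)"
    by (rule nn_integral_cmult_indicator[symmetric]) simp
  also have "\<dots> \<le> (\<integral>\<^sup>+\<rho>. emeasure lborel {x. (x, \<rho>) \<in> D} \<partial>PR)"
  proof (rule nn_integral_mono_AE)
    show "AE \<rho> in PR. ennreal (r / 2 * w) * indicator {w..} \<rho> \<le> emeasure lborel {x. (x, \<rho>) \<in> D}"
      using b
    proof eventually_elim
      case (elim \<rho>)
      show ?case
      proof (cases "w \<le> \<rho>")
        case True
        then show ?thesis
          using area_shadowing_diff[OF w(1) True elim r t] by (simp only: D_def) simp
      qed simp
    qed
  qed
  also have "\<dots> = emeasure intensity D"
    by (rule emeasure_intensity[symmetric]) (rule local_class_sets[OF D])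
  also have "\<dots> = ennreal (measure intensity D)"
    by (rule emeasure_intensity_eq_measure[OF D])
  finally show ?thesis by (simp add: D_def ennreal_le_iff)
qed

text \<open>Two of the angles \<open>i / K\<close> differ by at least \<open>1 / K\<close> and at
  most 1, as \<open>area_shadowing_diff\<close> demands; \<open>8 * w * K < r\<close> is its
  condition at the smallest gap. Each pair then has probability smaller by a factor
  \<open>exp (- (r * w / 4))\<close> than a single direction, and there are at most
  \<open>K * K\<close> pairs.\<close>

lemma prob_UN_clear_ge:
  fixes K :: nat and w b r :: real
  assumes w: "0 < w" "1 / 2 \<le> measure PR {w..}" and b: "AE \<rho> in PR. \<rho> \<le> b"
    and r: "0 \<le> r" "4 * b \<le> r" "8 * w * K < r"
  shows "prob (void origin_covering) * exp (- (2 * r * expectation R)) * (K - (real K)\<^sup>2 * exp (- (r * w / 4)))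
    \<le> prob (\<Union>i<K. clear r (i / K))"
proof -
  define p where "p = prob (void origin_covering) * exp (- (2 * r * expectation R))"
  have p: "0 \<le> p" by (simp add: p_def)
  have pair: "prob (clear r (j / K) \<inter> clear r (i / K)) \<le> p * exp (- (r * w / 4))"
    if "j < i" "i < K" for i j :: nat
  proof -
    let ?S = "shadowing r (dir (j / K))" and ?T = "shadowing r (dir (i / K))"
    define t where "t = (real i - real j) / K"
    have K: "0 < real K" using that by simp
    have "1 / K \<le> t" "t \<le> 1" using that K by (auto simp: t_def field_simps)
    have "8 * w < 1 / K * r" using r K by (simp add: field_simps)
    also have "\<dots> \<le> t * r" using \<open>1 / K \<le> t\<close> r(1) by (rule mult_right_mono)
    finally have "8 * w < t * r" .
    moreover have "0 \<le> t" using that by (simp add: t_def)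
    ultimately have t: "0 \<le> t" "t \<le> 1" "8 * w < t * r" using \<open>t \<le> 1\<close> by auto
    have "measure intensity (?S - ?T) = measure intensity (shadowing r (dir 0) - shadowing r (dir t))"
      using measure_intensity_Diff_shadowing_rot[OF r(1), of "j / K" 0 t]
      by (simp add: t_def add_divide_distrib[symmetric])
    also have "\<dots> \<ge> r * w / 4" by (rule measure_shadowing_Diff_ge[OF w b r(2) t])
    finally have ge: "2 * r * expectation R + r * w / 4 \<le> measure intensity (?S \<union> ?T)"
      using r by (simp add: measure_shadowing_Un)
    have "clear r (j / K) \<inter> clear r (i / K) = void (origin_covering \<union> (?S \<union> ?T))"
      by (auto simp: clear_def void_def)
    then have "prob (clear r (j / K) \<inter> clear r (i / K))
        = prob (void origin_covering) * exp (- measure intensity (?S \<union> ?T))"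
      using r origin_covering_Int_shadowing
      by (simp add: prob_void_origin_Un local_class_shadowing local_class_Un Int_Un_distrib)
    also have "\<dots> \<le> prob (void origin_covering) * exp (- (2 * r * expectation R + r * w / 4))"
      using ge by (intro mult_left_mono) auto
    also have "\<dots> = p * exp (- (r * w / 4))" by (simp add: p_def exp_add[symmetric])
    finally show ?thesis .
  qed
  have "(\<Sum>i<K. \<Sum>j<i. prob (clear r (j / K) \<inter> clear r (i / K)))
      \<le> (\<Sum>i<K. \<Sum>j<i. p * exp (- (r * w / 4)))"
    by (intro sum_mono pair) auto
  also have "\<dots> \<le> (\<Sum>i<K. real K * (p * exp (- (r * w / 4))))"
    using p by (intro sum_mono) (auto intro!: mult_right_mono)
  also have "\<dots> = p * ((real K)\<^sup>2 * exp (- (r * w / 4)))" by (simp add: power2_eq_square)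
  finally have "p * K - p * ((real K)\<^sup>2 * exp (- (r * w / 4)))
      \<le> (\<Sum>i<K. prob (clear r (i / K))) - (\<Sum>i<K. \<Sum>j<i. prob (clear r (j / K) \<inter> clear r (i / K)))"
    using r by (simp add: prob_clear p_def)
  also have "\<dots> \<le> prob (\<Union>i<K. clear r (i / K))"
    using r by (intro prob_UN_ge_Bonferroni clear_measurable)
  finally show ?thesis by (simp add: p_def[symmetric] right_diff_distrib)
qed

text \<open>For an arc shorter than pi, an obstacle shadowing both ends shadows the whole arc. So
  this event contains the existence of a clear direction in the arc, and it is a void event of a
  single class, whose probability is explicit.\<close>

definition unblocked :: "real \<Rightarrow> real \<Rightarrow> real \<Rightarrow> 'w set" where
  "unblocked r \<alpha> \<beta> = void (origin_covering \<union> (shadowing r (dir \<alpha>) \<inter> shadowing r (dir \<beta>)))"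

lemma unblocked_measurable: "0 \<le> r \<Longrightarrow> unblocked r \<alpha> \<beta> \<in> sets M"
  unfolding unblocked_def
  by (intro void_measurable local_class_sets local_class_Un local_class_Int
      local_class_origin_covering local_class_shadowing)

lemma clear_subset_unblocked:
  assumes "\<alpha> \<le> \<theta>" "\<theta> \<le> \<beta>" "\<beta> - \<alpha> < pi"
  shows "clear r \<theta> \<subseteq> unblocked r \<alpha> \<beta>"
  using shadowing_between[OF assms] by (auto simp: clear_def unblocked_def void_def)

lemma UN_clear_subset_unblocked:
  fixes K :: nat
  assumes "3 \<le> K"
  defines "\<delta> \<equiv> 2 * pi / real K"
  shows "(\<Union>\<theta>\<in>{0..<2 * pi}. clear r \<theta>) \<subseteq> (\<Union>j<K. unblocked r (real j * \<delta>) (real (Suc j) * \<delta>))"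
proof (rule UN_least)
  fix \<theta> assume \<theta>: "\<theta> \<in> {0..<2 * pi}"
  \<comment> \<open>Three arcs are enough to make each shorter than pi, as
    \<open>clear_subset_unblocked\<close> requires.\<close>
  have \<delta>: "0 < \<delta>" "\<delta> < pi" using assms by (auto simp: field_simps)
  define j where "j = nat \<lfloor>\<theta> / \<delta>\<rfloor>"
  have j: "real j \<le> \<theta> / \<delta>" "\<theta> / \<delta> < real j + 1"
    using \<theta> \<delta> by (auto simp: j_def)
  have "\<theta> / \<delta> < K" using \<theta> \<delta> assms by (simp add: \<delta>_def field_simps)
  with j have "j < K" by linarith
  moreover have "clear r \<theta> \<subseteq> unblocked r (real j * \<delta>) (real (Suc j) * \<delta>)"
    using j \<delta> by (intro clear_subset_unblocked) (auto simp: field_simps)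
  ultimately show "clear r \<theta> \<subseteq> (\<Union>j<K. unblocked r (real j * \<delta>) (real (Suc j) * \<delta>))" by blast
qed

text \<open>Among the arcs of the subdivision with no shadow covering them whole, either the first arc
  is one of them, or some arc is preceded by one that is covered; the last covering shadow then
  ends in between.\<close>
lemma prob_UN_unblocked_le:
  fixes K :: nat
  assumes r: "0 \<le> r" and K: "1 \<le> K"
  defines "\<delta> \<equiv> 2 * pi / real K"
    and "\<Lambda> \<equiv> pi * (2 * r * expectation R + r\<^sup>2)"
  shows "prob (\<Union>j<K. unblocked r (real j * \<delta>) (real (Suc j) * \<delta>))
    \<le> prob (void origin_covering) * exp (- (2 * r * expectation R) + \<Lambda> / K) * (1 + \<Lambda>)"
proof -
  define sh where "sh j = shadowing r (dir (real j * \<delta>))" for j :: nat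
  define G where "G j = unblocked r (real j * \<delta>) (real (Suc j) * \<delta>)" for j
  define d where "d = measure intensity (sh 0 - sh 1)"
  define p where "p = prob (void origin_covering) * exp (- (2 * r * expectation R - d))"
  have sh: "local_class (sh j)" for j unfolding sh_def by (rule local_class_shadowing[OF r])
  have p: "0 \<le> p" by (simp add: p_def)
  have d: "0 \<le> d" by (simp add: d_def)
  have G: "G j = void (origin_covering \<union> (sh j \<inter> sh (Suc j)))" for j
    by (simp add: G_def unblocked_def sh_def)
  have exit: "measure intensity (sh j - sh (Suc j)) = d" for j
    using measure_intensity_Diff_shadowing_rot[OF r, of "real j * \<delta>" 0 \<delta>]
    by (simp add: sh_def d_def algebra_simps)
  have disj: "origin_covering \<inter> (sh i \<inter> sh j) = {}" for i j
    using origin_covering_Int_shadowing by (auto simp: sh_def)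
  have covered: "measure intensity (sh j \<inter> sh (Suc j)) = 2 * r * expectation R - d" for j
    using measure_shadowing_Int[OF r] exit[of j] by (simp add: sh_def)
  have prob_G: "prob (G j) = p" for j
    unfolding G prob_void_origin_Un[OF local_class_Int[OF sh sh] disj] p_def covered ..
  \<comment> \<open>An obstacle covering arc \<open>j\<close> but not arc \<open>Suc j\<close>
    shadows the common end and misses the next one, so it belongs to a class of intensity
    \<open>d\<close>. Avoiding it as well multiplies the probability by at least
    \<open>exp (- d)\<close>, hence by at least \<open>1 - d\<close>.\<close>
  have step: "prob (G (Suc j)) - prob (G (Suc j) \<inter> G j) \<le> p * d" for j
  proof -
    let ?C = "sh j \<inter> sh (Suc j)" and ?C' = "sh (Suc j) \<inter> sh (Suc (Suc j))"
    let ?U = "?C' \<union> ?C"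
    have "measure intensity ?U = measure intensity (?C' \<union> (?C - ?C'))"
      by (intro arg_cong[where f="measure intensity"]) auto
    also have "\<dots> = measure intensity ?C' + measure intensity (?C - ?C')"
      by (intro measure_intensity_Un local_class_Int local_class_Diff sh) auto
    also have "\<dots> \<le> (2 * r * expectation R - d) + d"
    proof (rule add_mono)
      show "measure intensity ?C' \<le> 2 * r * expectation R - d" by (simp add: covered)
      have "measure intensity (?C - ?C') \<le> measure intensity (sh (Suc j) - sh (Suc (Suc j)))"
        by (intro measure_intensity_mono local_class_Int local_class_Diff sh) auto
      then show "measure intensity (?C - ?C') \<le> d" by (simp add: exit)
    qed
    finally have U: "measure intensity ?U \<le> (2 * r * expectation R - d) + d" .
    have "p * (1 - d) \<le> p * exp (- d)"
      using p exp_ge_add_one_self[of "- d"] by (intro mult_left_mono) auto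
    also have "\<dots> = prob (void origin_covering) * exp (- ((2 * r * expectation R - d) + d))"
      by (simp add: p_def exp_add[symmetric])
    also have "\<dots> \<le> prob (void origin_covering) * exp (- measure intensity ?U)"
      using U by (intro mult_left_mono) auto
    also have "\<dots> = prob (void (origin_covering \<union> ?U))"
      using disj by (subst prob_void_origin_Un)
        (auto simp: Int_Un_distrib intro!: local_class_Un local_class_Int sh)
    also have "void (origin_covering \<union> ?U) = G (Suc j) \<inter> G j"
      by (auto simp: G void_def)
    finally show ?thesis by (simp add: prob_G algebra_simps)
  qed
  \<comment> \<open>The exit classes of one full turn are disjoint, have equal intensity by
    rotation, and consist of obstacles in the annulus. This bounds both the total of the
    \<open>d\<close> terms and the single \<open>d\<close>, without computing
    \<open>d\<close>.\<close>
  have Kd: "K * d \<le> \<Lambda>"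
  proof -
    have "K * d = (\<Sum>j<K. measure intensity (sh j - sh (Suc j)))" by (simp add: exit)
    also have "\<dots> = measure intensity (\<Union>j<K. sh j - sh (Suc j))"
    proof (rule measure_finite_Union[symmetric])
      show "disjoint_family_on (\<lambda>j. sh j - sh (Suc j)) {..<K}"
        unfolding sh_def \<delta>_def by (rule disjoint_shadowing_exits)
      show "emeasure intensity (sh j - sh (Suc j)) \<noteq> \<infinity>" for j
        using emeasure_intensity_finite[OF local_class_Diff[OF sh sh], of j "Suc j"] by simp
      show "(\<lambda>j. sh j - sh (Suc j)) ` {..<K} \<subseteq> sets intensity"
        unfolding sets_intensity using local_class_sets[OF local_class_Diff[OF sh sh]] by blast
    qed simp
    also have "\<dots> \<le> measure intensity (annulus r)"
    proof (intro measure_intensity_mono local_class_annulus)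
      show sub: "(\<Union>j<K. sh j - sh (Suc j)) \<subseteq> annulus r"
        using shadowing_subset_annulus[OF norm_dir] by (auto simp: sh_def)
      show "local_class (\<Union>j<K. sh j - sh (Suc j))"
        by (rule local_class_subset[OF local_class_annulus sub])
           (intro sets.finite_UN sets.Diff local_class_sets sh finite_lessThan)
    qed
    finally show ?thesis using r by (simp add: measure_annulus \<Lambda>_def)
  qed
  have "{..<K} = {..K - 1}" using K by auto
  then have "prob (\<Union>j<K. G j) = prob (\<Union>j\<le>K - 1. G j)" by simp
  also have "\<dots> \<le> prob (G 0) + (\<Sum>j<K - 1. prob (G (Suc j)) - prob (G (Suc j) \<inter> G j))"
    by (rule prob_UN_le_chain) (simp add: G_def unblocked_measurable[OF r])
  also have "\<dots> \<le> p + (\<Sum>j<K - 1. p * d)"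
    by (intro add_mono sum_mono step) (simp add: prob_G)
  also have "\<dots> = p * (1 + (real K - 1) * d)"
  proof -
    have "real (K - 1) = real K - 1" using K by (simp add: of_nat_diff)
    then show ?thesis by (simp add: distrib_left)
  qed
  also have "\<dots> \<le> p * (1 + \<Lambda>)"
  proof (rule mult_left_mono[OF _ p])
    show "1 + (real K - 1) * d \<le> 1 + \<Lambda>" using Kd d unfolding left_diff_distrib by linarith
  qed
  also have "\<dots> \<le> prob (void origin_covering) * exp (- (2 * r * expectation R) + \<Lambda> / K) * (1 + \<Lambda>)"
  proof (rule mult_right_mono)
    have "d \<le> \<Lambda> / K" using Kd K by (simp add: field_simps)
    then show "p \<le> prob (void origin_covering) * exp (- (2 * r * expectation R) + \<Lambda> / K)"
      unfolding p_def by (intro mult_left_mono) auto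
    show "0 \<le> 1 + \<Lambda>" using r expectation_R_pos by (simp add: \<Lambda>_def)
  qed
  finally show ?thesis unfolding G_def .
qed

end

section \<open>Bounds on the visibility\<close>

context planar_boolean_model
begin

text \<open>Off a null set only finitely many discs come within distance \<open>r\<close>. Each
  blocks a closed set of angles, so the clear angles form an open set, which contains a rational as
  soon as it is nonempty. The uncountable union thus agrees with a countable one off a null
  set.\<close>

lemma UN_clear_sets_completion:
  assumes r: "0 \<le> r"
  shows "(\<Union>\<theta>. clear r \<theta>) \<in> sets (completion M)"
proof -
  obtain b where b: "AE \<rho> in PR. \<rho> \<le> b" by (rule PR_bounded)
  have "AE \<omega> in M. finite {n. X n \<omega> \<in> cball 0 (r + b)} \<and> (\<forall>n. Rad n \<omega> \<le> b)"
    using poisson_locally_finite[OF germs_poisson bounded_cball, of 0 "r + b"] radii_bounded[OF b]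
    by eventually_elim simp
  then obtain N where N: "N \<in> null_sets M"
    and good: "\<And>\<omega>. \<omega> \<in> space M - N \<Longrightarrow> finite {n. X n \<omega> \<in> cball 0 (r + b)} \<and> (\<forall>n. Rad n \<omega> \<le> b)"
    unfolding eventually_ae_filter by blast
  define A where "A = (\<Union>\<theta>. clear r \<theta>)"
  define B where "B = (\<Union>\<theta>\<in>\<rat>. clear r \<theta>)"
  have "A - N \<subseteq> B"
  proof
    fix \<omega> assume "\<omega> \<in> A - N"
    then obtain \<theta> where \<theta>: "\<omega> \<in> clear r \<theta>" and "\<omega> \<notin> N" by (auto simp: A_def)
    then have \<omega>: "\<omega> \<in> space M" by (auto simp: clear_def void_def)
    define I where "I = {n. X n \<omega> \<in> cball 0 (r + b)}"
    have I: "finite I" "\<And>n. Rad n \<omega> \<le> b" using good \<omega> \<open>\<omega> \<notin> N\<close> by (auto simp: I_def)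
    define S where "S n = {\<phi>. norm (max 0 (min r (dir \<phi> \<bullet> X n \<omega>)) *\<^sub>R dir \<phi> - X n \<omega>) \<le> Rad n \<omega>}" for n
    have S_iff: "\<phi> \<in> S n \<longleftrightarrow> (\<exists>s. 0 \<le> s \<and> s \<le> r \<and> s *\<^sub>R dir \<phi> \<in> cball (X n \<omega>) (Rad n \<omega>))" for \<phi> n
      using segment_meets_cball_iff[OF norm_dir r] by (simp add: S_def)
    have clear_S: "\<omega> \<in> clear r \<phi> \<longleftrightarrow> (\<forall>n. \<phi> \<notin> S n)" for \<phi>
      unfolding clear_iff[OF r] S_iff occupied_phase_def using \<omega> by blast
    have outside: "\<phi> \<notin> S n" if "n \<notin> I" for \<phi> n
    proof
      assume "\<phi> \<in> S n"
      then obtain s where s: "0 \<le> s" "s \<le> r" "norm (X n \<omega> - s *\<^sub>R dir \<phi>) \<le> Rad n \<omega>"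
        unfolding S_iff by (auto simp: dist_norm)
      then have "norm (X n \<omega>) \<le> r + b"
        using norm_triangle_sub[of "X n \<omega>" "s *\<^sub>R dir \<phi>"] I(2)[of n] by simp
      with that show False by (simp add: I_def)
    qed
    have "closed (S n)" for n
      unfolding S_def by (intro closed_Collect_le continuous_intros)
    then have "open (- (\<Union>n\<in>I. S n))" using I(1) by (intro open_Compl closed_UN) auto
    moreover have "\<theta> \<in> - (\<Union>n\<in>I. S n)" using \<theta> by (simp add: clear_S)
    ultimately obtain e where e: "0 < e" "ball \<theta> e \<subseteq> - (\<Union>n\<in>I. S n)"
      by (rule openE)
    obtain q where q: "q \<in> \<rat>" "\<theta> < q" "q < \<theta> + e"
      using Rats_dense_in_real[of \<theta> "\<theta> + e"] e by auto
    then have "q \<in> ball \<theta> e" by (simp add: dist_real_def)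
    then have "q \<notin> S n" for n using e(2) outside[of n q] by (cases "n \<in> I") auto
    then have "\<omega> \<in> clear r q" by (simp add: clear_S)
    then show "\<omega> \<in> B" using q by (auto simp: B_def)
  qed
  moreover have "B \<in> sets M"
    unfolding B_def using r by (intro sets.countable_UN' countable_rat) (auto intro: clear_measurable)
  moreover have "B \<subseteq> A" by (auto simp: A_def B_def)
  ultimately have "A \<in> sets (completion M)"
    using N by (intro sets_completionI[of A B "A \<inter> N" N]) auto
  then show ?thesis by (simp add: A_def)
qed

lemma clear_imp_total_visibility_ge:
  assumes "0 \<le> r" "\<omega> \<in> clear r \<theta>"
  shows "ereal r \<le> total_visibility (occupied_phase X Rad \<omega>)"
proof -
  have "ereal r \<le> visibility (occupied_phase X Rad \<omega>) (dir \<theta>)"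
    unfolding visibility_def
  proof (rule Inf_greatest)
    fix v assume "v \<in> {ereal s |s. 0 < s \<and> s *\<^sub>R dir \<theta> \<in> occupied_phase X Rad \<omega>}"
    then obtain s where "v = ereal s" "0 < s" "s *\<^sub>R dir \<theta> \<in> occupied_phase X Rad \<omega>" by blast
    then show "ereal r \<le> v" using assms by (auto simp: clear_iff not_less[symmetric])
  qed
  also have "\<dots> \<le> total_visibility (occupied_phase X Rad \<omega>)"
    unfolding total_visibility_def by (rule SUP_upper) simp
  finally show ?thesis .
qed

text \<open>The inequality is strict for two reasons: the supremum need not be attained, and a disc
  may be met at distance \<open>r\<close> itself.\<close>

lemma total_visibility_gt_imp_clear:
  assumes "0 \<le> r" "ereal r < total_visibility (occupied_phase X Rad \<omega>)"
    and "\<omega> \<in> space M" "0 \<notin> occupied_phase X Rad \<omega>"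
  obtains \<theta> where "\<theta> \<in> {0..<2 * pi}" "\<omega> \<in> clear r \<theta>"
proof -
  obtain u where u: "norm u = 1" "ereal r < visibility (occupied_phase X Rad \<omega>) u"
    using assms(2) by (auto simp: total_visibility_def less_SUP_iff)
  obtain \<theta> where \<theta>: "0 \<le> \<theta>" "\<theta> < 2 * pi" "u = dir \<theta>" by (rule norm_1_imp_dir[OF u(1)])
  have "s *\<^sub>R dir \<theta> \<notin> occupied_phase X Rad \<omega>" if s: "0 \<le> s" "s \<le> r" for s
  proof (cases "s = 0")
    case False
    show ?thesis
    proof
      assume "s *\<^sub>R dir \<theta> \<in> occupied_phase X Rad \<omega>"
      then have "visibility (occupied_phase X Rad \<omega>) u \<le> ereal s"
        unfolding visibility_def using False s \<theta> by (intro Inf_lower) auto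
      with u(2) have "ereal r < ereal s" by (rule less_le_trans)
      with s show False by simp
    qed
  qed (use assms in simp)
  then show thesis using that \<theta> assms by (auto simp: clear_iff)
qed

definition far_sighted :: "real \<Rightarrow> 'w set" where
  "far_sighted r = {\<omega> \<in> space M. ereal r \<le> total_visibility (occupied_phase X Rad \<omega>)
     \<and> 0 \<notin> occupied_phase X Rad \<omega>}"

lemma clear_subset_far_sighted: "0 \<le> r \<Longrightarrow> clear r \<theta> \<subseteq> far_sighted r"
  using clear_imp_total_visibility_ge[of r _ \<theta>]
  by (fastforce simp: far_sighted_def clear_iff dest: spec[of _ 0])

lemma far_sighted_subset_UN_clear:
  assumes "0 \<le> r'" "r' < r"
  shows "far_sighted r \<subseteq> (\<Union>\<theta>\<in>{0..<2 * pi}. clear r' \<theta>)"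
proof
  fix \<omega> assume \<omega>: "\<omega> \<in> far_sighted r"
  have "ereal r' < ereal r" using assms by simp
  also have "\<dots> \<le> total_visibility (occupied_phase X Rad \<omega>)" using \<omega> by (simp add: far_sighted_def)
  finally have gt: "ereal r' < total_visibility (occupied_phase X Rad \<omega>)" .
  obtain \<theta> where "\<theta> \<in> {0..<2 * pi}" "\<omega> \<in> clear r' \<theta>"
    by (rule total_visibility_gt_imp_clear[OF assms(1) gt])
      (use \<omega> in \<open>simp_all add: far_sighted_def\<close>)
  then show "\<omega> \<in> (\<Union>\<theta>\<in>{0..<2 * pi}. clear r' \<theta>)" by blast
qed

text \<open>A supremum is at least \<open>r\<close> iff it exceeds every smaller number. Lengths
  \<open>\<rho> k\<close> below \<open>r\<close> and converging to \<open>r\<close> therefore write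
  the event as a countable intersection of events already known to be measurable.\<close>

lemma far_sighted_sets_completion:
  assumes "0 < r"
  shows "far_sighted r \<in> sets (completion M)"
proof -
  define \<rho> where "\<rho> k = r * (1 - inverse (real (Suc k)))" for k
  have \<rho>: "0 \<le> \<rho> k" "\<rho> k < r" for k
    using assms by (auto simp: \<rho>_def field_simps)
  have "far_sighted r = (\<Inter>k. \<Union>\<theta>. clear (\<rho> k) \<theta>)"
  proof (intro equalityI subsetI)
    fix \<omega> assume "\<omega> \<in> far_sighted r"
    then show "\<omega> \<in> (\<Inter>k. \<Union>\<theta>. clear (\<rho> k) \<theta>)"
      using far_sighted_subset_UN_clear[OF \<rho>] by blast
  next
    fix \<omega> assume \<omega>: "\<omega> \<in> (\<Inter>k. \<Union>\<theta>. clear (\<rho> k) \<theta>)"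
    then have far: "\<omega> \<in> far_sighted (\<rho> k)" for k
      using clear_subset_far_sighted[OF \<rho>(1)] by blast
    have "\<rho> \<longlonglongrightarrow> r * (1 - 0)"
      unfolding \<rho>_def by (intro tendsto_intros LIMSEQ_inverse_real_of_nat)
    then have "(\<lambda>k. ereal (\<rho> k)) \<longlonglongrightarrow> ereal r" by simp
    then have "ereal r \<le> total_visibility (occupied_phase X Rad \<omega>)"
      by (rule LIMSEQ_le_const2) (use far in \<open>simp add: far_sighted_def\<close>)
    then show "\<omega> \<in> far_sighted r" using far[of 0] by (simp add: far_sighted_def)
  qed
  also have "\<dots> \<in> sets (completion M)"
    using \<rho> by (intro sets.countable_INT) (auto intro: UN_clear_sets_completion)
  finally show ?thesis .
qed

lemma visibility_prob_eq:
  "visibility_prob M X Rad r = measure (completion M) (far_sighted r) / prob (void origin_covering)"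
proof -
  have "{\<omega> \<in> space M. 0 \<notin> occupied_phase X Rad \<omega>} = void origin_covering"
    by (auto simp: void_def origin_covering_def occupied_phase_def)
  moreover have "void origin_covering \<in> sets M"
    by (intro void_measurable local_class_sets local_class_origin_covering)
  ultimately show ?thesis
    by (simp add: visibility_prob_def cond_prob_def far_sighted_def)
qed

lemma prob_void_origin_pos: "0 < prob (void origin_covering)"
  by (simp add: prob_void local_class_origin_covering)

lemma finite_measure_completion: "finite_measure (completion M)"
  by (rule finite_measureI) (simp add: emeasure_space_1)

section \<open>Bounds at a given distance\<close>

lemma visibility_prob_le:
  assumes "0 \<le> r'" "r' < r"
  shows "visibility_prob M X Rad r
    \<le> exp (- (2 * r' * expectation R)) * (1 + pi * (2 * r' * expectation R + r'\<^sup>2))"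
proof -
  define \<Lambda> where "\<Lambda> = pi * (2 * r' * expectation R + r'\<^sup>2)"
  define p0 where "p0 = prob (void origin_covering)"
  have bound: "measure (completion M) (far_sighted r)
      \<le> p0 * exp (- (2 * r' * expectation R) + \<Lambda> / K) * (1 + \<Lambda>)" if K: "3 \<le> K" for K :: nat
  proof -
    define U where "U = (\<Union>j<K. unblocked r' (real j * (2 * pi / K)) (real (Suc j) * (2 * pi / K)))"
    have U: "U \<in> sets M"
      unfolding U_def by (intro sets.finite_UN unblocked_measurable assms) auto
    have "far_sighted r \<subseteq> U"
      using far_sighted_subset_UN_clear[OF assms] UN_clear_subset_unblocked[OF K, of r']
      unfolding U_def by blast
    then have "measure (completion M) (far_sighted r) \<le> measure (completion M) U"
      using U by (intro finite_measure.finite_measure_mono[OF finite_measure_completion]) auto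
    also have "\<dots> = prob U" using U by simp
    also have "\<dots> \<le> p0 * exp (- (2 * r' * expectation R) + \<Lambda> / K) * (1 + \<Lambda>)"
      unfolding U_def p0_def \<Lambda>_def using K by (intro prob_UN_unblocked_le assms) simp
    finally show ?thesis .
  qed
  have "(\<lambda>K. p0 * exp (- (2 * r' * expectation R) + \<Lambda> / real K) * (1 + \<Lambda>))
      \<longlonglongrightarrow> p0 * exp (- (2 * r' * expectation R) + 0) * (1 + \<Lambda>)"
    by (intro tendsto_intros lim_const_over_n)
  then have "measure (completion M) (far_sighted r)
      \<le> p0 * exp (- (2 * r' * expectation R) + 0) * (1 + \<Lambda>)"
    using bound by (intro LIMSEQ_le_const) (auto intro!: exI[of _ 3])
  then show ?thesis
    using prob_void_origin_pos
    unfolding visibility_prob_eq p0_def[symmetric] \<Lambda>_def[symmetric]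
    by (simp add: pos_divide_le_eq mult_ac)
qed

lemma visibility_prob_ge:
  fixes K :: nat and w b r :: real
  assumes w: "0 < w" "1 / 2 \<le> measure PR {w..}" and b: "AE \<rho> in PR. \<rho> \<le> b"
    and r: "0 < r" "4 * b \<le> r" "8 * w * K < r"
  shows "exp (- (2 * r * expectation R)) * (K - (real K)\<^sup>2 * exp (- (r * w / 4))) \<le> visibility_prob M X Rad r"
proof -
  define U where "U = (\<Union>i<K. clear r (i / K))"
  have U: "U \<in> sets M" unfolding U_def using r by (intro sets.finite_UN clear_measurable) auto
  have "prob (void origin_covering) * exp (- (2 * r * expectation R)) * (K - (real K)\<^sup>2 * exp (- (r * w / 4))) \<le> prob U"
    unfolding U_def by (rule prob_UN_clear_ge[OF w b _ r(2,3)]) (use r in simp)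
  also have "\<dots> = measure (completion M) U" using U by simp
  also have "\<dots> \<le> measure (completion M) (far_sighted r)"
  proof (rule finite_measure.finite_measure_mono[OF finite_measure_completion])
    show "U \<subseteq> far_sighted r" unfolding U_def using clear_subset_far_sighted r by (intro UN_least) auto
  qed (rule far_sighted_sets_completion[OF r(1)])
  finally show ?thesis
    using prob_void_origin_pos by (simp add: visibility_prob_eq pos_le_divide_eq mult_ac)
qed

text \<open>The radii are positive but may come arbitrarily close to 0; this level \<open>w\<close>
  gives a positive fraction of the obstacles a definite size. It exists by continuity of the measure
  along the sets increasing to the positive half-line.\<close>

lemma PR_atLeast_ge_half: obtains w where "0 < w" "1 / 2 \<le> measure PR {w..}"
proof -
  have "(\<lambda>n. measure PR {inverse (real (Suc n))..}) \<longlonglongrightarrow> measure PR (\<Union>n. {inverse (real (Suc n))..})"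
  proof (rule PR.finite_Lim_measure_incseq)
    show "incseq (\<lambda>n. {inverse (real (Suc n))..})"
      by (auto simp: incseq_def intro: order_trans[rotated] simp del: of_nat_Suc)
  qed auto
  also have "(\<Union>n. {inverse (real (Suc n))..}) = {0<..}"
  proof (intro equalityI subsetI)
    fix x assume "x \<in> (\<Union>n. {inverse (real (Suc n))..})"
    then obtain n where "inverse (real (Suc n)) \<le> x" by blast
    moreover have "0 < inverse (real (Suc n))" by simp
    ultimately show "x \<in> {0<..}" unfolding greaterThan_iff by linarith
  next
    fix x :: real assume "x \<in> {0<..}"
    then obtain n where "inverse (real (Suc n)) < x" using reals_Archimedean[of x] by auto
    then show "x \<in> (\<Union>n. {inverse (real (Suc n))..})" by (blast intro: less_imp_le)
  qed
  also have "measure PR {0<..} = 1"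
    using PR_pos by (intro PR.prob_eq_1[THEN iffD2]) auto
  finally have "eventually (\<lambda>n. 1 / 2 < measure PR {inverse (real (Suc n))..}) sequentially"
    by (rule order_tendstoD) simp
  then obtain n where "1 / 2 < measure PR {inverse (real (Suc n))..}"
    by (auto simp: eventually_sequentially)
  then show thesis by (intro that[of "inverse (real (Suc n))"]) auto
qed

section \<open>Choice of parameters for large distances\<close>

lemma eventually_visibility_prob_le:
  "\<forall>\<^sub>F r in at_top. visibility_prob M X Rad r
     \<le> 2 * (pi * (2 * r * expectation R + r\<^sup>2) + 2) * exp (- (2 * r * expectation R))"
proof -
  let ?E = "expectation R"
  \<comment> \<open>Chosen so that replacing \<open>r\<close> by \<open>r - h\<close> multiplies
    \<open>exp (- (2 * r * ?E))\<close> by exactly 2.\<close>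
  define h where "h = ln 2 / (2 * ?E)"
  have h: "0 < h" "2 * h * ?E = ln 2" using expectation_R_pos by (auto simp: h_def)
  show ?thesis
    using eventually_ge_at_top[of h]
  proof eventually_elim
    case (elim r)
    have "visibility_prob M X Rad r
        \<le> exp (- (2 * (r - h) * ?E)) * (1 + pi * (2 * (r - h) * ?E + (r - h)\<^sup>2))"
      using elim h by (intro visibility_prob_le) auto
    also have "exp (- (2 * (r - h) * ?E)) = 2 * exp (- (2 * r * ?E))"
    proof -
      have "- (2 * (r - h) * ?E) = ln 2 + - (2 * r * ?E)" using h by (simp add: algebra_simps)
      then show ?thesis by (simp only: exp_add) simp
    qed
    also have "2 * exp (- (2 * r * ?E)) * (1 + pi * (2 * (r - h) * ?E + (r - h)\<^sup>2))
        \<le> 2 * exp (- (2 * r * ?E)) * (2 + pi * (2 * r * ?E + r\<^sup>2))"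
      using elim h expectation_R_pos
      by (intro mult_left_mono add_mono power_mono mult_right_mono) auto
    finally show ?case by (simp only: mult_ac add_ac)
  qed
qed

lemma eventually_visibility_prob_ge:
  "\<forall>\<^sub>F r in at_top. visibility_prob M X Rad r
     \<ge> 2 * (2 * r * expectation R) * exp (- (2 * r * expectation R)) + exp (- (2 * (2 * r * expectation R)))"
proof -
  let ?E = "expectation R"
  obtain b where b: "AE \<rho> in PR. \<rho> \<le> b" by (rule PR_bounded)
  obtain w0 where w0: "0 < w0" "1 / 2 \<le> measure PR {w0..}" by (rule PR_atLeast_ge_half)
  \<comment> \<open>For \<open>r \<ge> 1\<close> this dominates the number of directions:
    \<open>K \<le> 4 * r * ?E + 3 \<le> C * r\<close>.\<close>
  define C where "C = 4 * ?E + 3"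
  have C: "0 < C" using expectation_R_pos by (simp add: C_def)
  \<comment> \<open>The condition \<open>8 * w * K < r\<close> follows from
    \<open>K \<le> C * r\<close> once \<open>16 * w * C \<le> 1\<close>. Lowering \<open>w0\<close>
    to this value keeps at least half of the radii above it.\<close>
  define w where "w = min w0 (1 / (16 * C))"
  have w: "0 < w" using w0 C by (simp add: w_def)
  have "measure PR {w0..} \<le> measure PR {w..}"
    by (intro PR.finite_measure_mono) (auto simp: w_def)
  then have w_half: "1 / 2 \<le> measure PR {w..}" using w0 by simp
  have "w \<le> 1 / (16 * C)" by (simp add: w_def)
  then have wC: "16 * w * C \<le> 1" using C by (simp add: field_simps)
  \<comment> \<open>This is \<open>(C * r)\<^sup>2 * exp (- (r * w / 4))\<close>, a bound for the
    pair term, written in the variable \<open>w / 4 * r\<close>.\<close>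
  have "((\<lambda>r. (4 * C / w)\<^sup>2 * ((w / 4 * r) ^ 2 / exp (w / 4 * r))) \<longlongrightarrow> (4 * C / w)\<^sup>2 * 0) at_top"
    by (intro tendsto_intros filterlim_compose[OF tendsto_power_div_exp_0]
        filterlim_tendsto_pos_mult_at_top[OF tendsto_const _ filterlim_ident]) (use w in simp)
  then have "\<forall>\<^sub>F r in at_top. (4 * C / w)\<^sup>2 * ((w / 4 * r) ^ 2 / exp (w / 4 * r)) < 1"
    by (rule order_tendstoD) simp
  then show ?thesis
    using eventually_ge_at_top[of "4 * b"] eventually_ge_at_top[of 1]
  proof eventually_elim
    case (elim r)
    define a where "a = 2 * r * ?E"
    have a: "0 \<le> a" using elim expectation_R_pos by (simp add: a_def)
    \<comment> \<open>The target is \<open>exp (- a) * (2 * a + exp (- a))\<close>. Its bracket is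
      at most \<open>2 * a + 1\<close>, so \<open>K \<ge> 2 * a + 2\<close> leaves room for a pair
      term of at most 1.\<close>
    define K where "K = nat \<lceil>2 * a + 2\<rceil>"
    have K: "2 * a + 2 \<le> real K" "real K \<le> 2 * a + 3"
      unfolding K_def using a by linarith+
    note K(2)
    also have "2 * a + 3 \<le> C * r" using elim by (simp add: a_def C_def algebra_simps)
    finally have K_le: "real K \<le> C * r" .
    have "8 * w * K \<le> 8 * w * (C * r)" using K_le w by (intro mult_left_mono) auto
    also have "\<dots> = 16 * w * C * (r / 2)" by simp
    also have "\<dots> \<le> 1 * (r / 2)" using wC elim by (intro mult_right_mono) auto
    also have "\<dots> < r" using elim by simp
    finally have small: "8 * w * K < r" .
    have "(real K)\<^sup>2 * exp (- (r * w / 4)) \<le> (C * r)\<^sup>2 * exp (- (r * w / 4))"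
      using K_le by (intro mult_right_mono power_mono) auto
    also have "\<dots> = (4 * C / w)\<^sup>2 * ((w / 4 * r) ^ 2 / exp (w / 4 * r))"
      using w by (simp add: exp_minus field_simps power2_eq_square)
    finally have "(real K)\<^sup>2 * exp (- (r * w / 4)) \<le> 1" using elim(1) by linarith
    then have "2 * a + exp (- a) \<le> K - (real K)\<^sup>2 * exp (- (r * w / 4))"
    proof -
      have "exp (- a) \<le> 1" using a by simp
      then show ?thesis using K(1) \<open>(real K)\<^sup>2 * exp (- (r * w / 4)) \<le> 1\<close> by linarith
    qed
    then have "exp (- a) * (2 * a + exp (- a)) \<le> exp (- a) * (K - (real K)\<^sup>2 * exp (- (r * w / 4)))"
      by (rule mult_left_mono) simp
    also have "\<dots> \<le> visibility_prob M X Rad r"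
      unfolding a_def using elim by (intro visibility_prob_ge[OF w w_half b _ _ small]) auto
    finally show ?case
      using exp_double[of "- a"] unfolding a_def[symmetric]
      by (simp add: power2_eq_square distrib_left mult_ac)
  qed
qed

end

theorem mainTheorem6:
  fixes M :: "'w measure"
    and X :: "nat \<Rightarrow> 'w \<Rightarrow> real ^ 2"
    and Rad :: "nat \<Rightarrow> 'w \<Rightarrow> real"
    and R :: "'w \<Rightarrow> real"
    and ER :: real
    and m :: "real \<Rightarrow> real"
  assumes model: "planar_boolean_model M X Rad R"
    and ER: "ER = (\<integral>\<omega>. R \<omega> \<partial>M)"
    and m: "\<And>r. m r = mean_shadow (distr M borel R) r"
  shows "(\<forall>\<^sub>F r in at_top.
           visibility_prob M X Rad r
             \<le> 2 * (pi * (2 * r * ER + r\<^sup>2) + 2) * exp (- (pi * (2 * r * ER + r\<^sup>2) * m r)) \<and>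
           visibility_prob M X Rad r
             \<ge> 2 * pi * m r * (2 * r * ER + r\<^sup>2) * exp (- (pi * m r * (2 * r * ER + r\<^sup>2)))
               + exp (- (2 * pi * m r * (2 * r * ER + r\<^sup>2))))
         \<and> m \<sim>[at_top] (\<lambda>r. 2 * ER / (pi * r))"
proof
  interpret planar_boolean_model M X Rad R by (rule model)
  show "m \<sim>[at_top] (\<lambda>r. 2 * ER / (pi * r))"
    using mean_shadow_asymp by (simp add: m[abs_def] ER)
  show "\<forall>\<^sub>F r in at_top.
           visibility_prob M X Rad r
             \<le> 2 * (pi * (2 * r * ER + r\<^sup>2) + 2) * exp (- (pi * (2 * r * ER + r\<^sup>2) * m r)) \<and>
           visibility_prob M X Rad r
             \<ge> 2 * pi * m r * (2 * r * ER + r\<^sup>2) * exp (- (pi * m r * (2 * r * ER + r\<^sup>2)))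
               + exp (- (2 * pi * m r * (2 * r * ER + r\<^sup>2)))"
    using eventually_visibility_prob_le eventually_visibility_prob_ge eventually_gt_at_top[of 0]
  proof eventually_elim
    case (elim r)
    \<comment> \<open>Positivity lets the number of obstacles cancel against the denominator of
      \<open>mean_shadow_eq\<close>; every occurrence of \<open>m r\<close> in the bounds then
      reduces to \<open>2 * r * ER\<close>.\<close>
    have "0 < 2 * r * ER + r\<^sup>2"
      using elim(3) expectation_R_pos by (intro add_pos_pos) (auto simp: ER)
    then have mean: "pi * (2 * r * ER + r\<^sup>2) * m r = 2 * r * ER"
      using elim(3) by (simp add: m mean_shadow_eq flip: ER)
    have mean': "pi * m r * (2 * r * ER + r\<^sup>2) = 2 * r * ER"
      using mean by (simp only: mult_ac)
    have mean2: "2 * pi * m r * (2 * r * ER + r\<^sup>2) = 2 * (2 * r * ER)"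
      using arg_cong[OF mean', of "(*) 2"] by (simp only: mult.assoc)
    show ?case using elim(1,2) by (simp only: mean mean' mean2 flip: ER)
  qed
qed

end
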